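(* Let $\mathcal{P}_{XYZ}$ be a fixed pmf on $\mathcal{X}\times\mathcal{Y}\times\mathcal{Z}$, and let $E_P(\cdot)$ and $E_Q(\cdot)$ be the error exponent functions of the problem of testing $\mathcal{P}_{XYZ}$ against the family $\{\mathcal{Q}_Z\mathcal{P}_{X|Z}\mathcal{P}_{Y|Z}\}_{\mathcal{Q}_Z}$, as defined in the context. Then, for all $E_Q,E_P\in\mathbb{R}$, their biconjugates satisfy $$E_P^{\star\star}(E_Q)=\sup_{\alpha\in(0,1]}\frac{1-\alpha}{\alpha}\left(I^Z_\alpha(X,Y|Z)-E_Q\right),$$ $$E_Q^{\star\star}(E_P)=\sup_{\alpha\in(0,1]}\left(I^Z_\alpha(X,Y|Z)-\frac{\alpha}{1-\alpha}E_P\right).$$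
   Context: Hypothesis testing problem: one observes triples $\{(X_i,Y_i,Z_i)\}_{i=1}^n$. Under the null hypothesis they are i.i.d. from $\mathcal{P}_{XYZ}$; under the alternative they are i.i.d. from $\mathcal{Q}_Z\mathcal{P}_{X|Z}\mathcal{P}_{Y|Z}$ for some arbitrary pmf $\mathcal{Q}_Z$ on $\mathcal{Z}$, where $\mathcal{P}_{X|Z},\mathcal{P}_{Y|Z}$ are the conditional pmfs induced by $\mathcal{P}_{XYZ}$ (fixed arbitrarily where $\mathcal{P}_Z(z)=0$), and $\mathcal{Q}_Z\mathcal{P}_{X|Z}\mathcal{P}_{Y|Z}$ is the pmf $(x,y,z)\mapsto\mathcal{Q}_Z(z)\mathcal{P}_{X|Z=z}(x)\mathcal{P}_{Y|Z=z}(y)$. A test is a map $T_n:\{\mathcal{X}\times\mathcal{Y}\times\mathcal{Z}\}^n\to\{0,1\}$ (0 = null, 1 = alternative). A pair $(E_P,E_Q)\in\mathbb{R}^2$ is achievable if there is a sequence of tests $\{T_n\}_{n\ge1}$ with $$\liminf_{n\to\infty}-\frac1n\log\mathcal{P}_{XYZ}^{\otimes n}(T_n=1)>E_P,\qquad \liminf_{n\to\infty}\inf_{\mathcal{Q}_Z}-\frac1n\log(\mathcal{Q}_Z\mathcal{P}_{X|Z}\mathcal{P}_{Y|Z})^{\otimes n}(T_n=0)>E_Q$$ (with $-\log 0=+\infty$). The error exponent functions $E_P,E_Q:\mathbb{R}\to\mathbb{R}\cup\{+\infty\}$ are $E_P(E_Q)=\sup\{E_P\in\mathbb{R}:(E_P,E_Q)\text{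 is achievable}\}$ and $E_Q(E_P)=\sup\{E_Q\in\mathbb{R}:(E_P,E_Q)\text{ is achievable}\}$ (the same symbols are used for the functions and for their real arguments). Convex conjugate: for $f:\mathbb{R}\to[-\infty,+\infty]$, $f^\star(\lambda)=\sup_{x\in\mathbb{R}}(\lambda x-f(x))$, and $f^{\star\star}=(f^\star)^\star$. Rényi divergence: for $\alpha>0$, $\alpha\neq 1$, $D_\alpha(\mathcal{P}\|\mathcal{Q})=\frac{1}{\alpha-1}\log\int p^\alpha q^{1-\alpha}\,d\mu$ for densities $p,q$ with respect to a common dominating measure $\mu$; $D_1$ is the Kullback–Leibler divergence. $\log$ is the natural logarithm. $I^{Z}_\alpha(X,Y|Z)=\min_{\mathcal{Q}_{Z}} D_\alpha(\mathcal{P}_{XYZ}\|\mathcal{P}_{X|Z}\mathcal{P}_{Y|Z}\mathcal{Q}_Z)$, the minimum being over all pmfs $\mathcal{Q}_Z$ on $\mathcal{Z}$. Conventions at $\alpha=1$: $0\cdot\infty=0$ in the first formula; in the second formula $\frac{\alpha}{1-\alpha}E_P$ is read as $+\infty$, $0$, $-\infty$ for $E_P>0$, $E_P=0$, $E_P<0$ respectively, and the whole term as $-\infty$ when $E_P>0$. *)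

theory Defs
  imports "HOL-Probability.Probability"
begin

text \<open>
  Alphabets are types and pmfs are elements of \<^typ>\<open>'a pmf\<close>, which have countable support;
  finiteness of the alphabets is not assumed.  All logarithms are natural.
\<close>

definition log_ennreal :: "ennreal \<Rightarrow> ereal" where
  "log_ennreal x = (if x = 0 then -\<infinity> else if x = \<infinity> then \<infinity> else ereal (ln (enn2real x)))"


subsection \<open>Conditional pmfs\<close>

text \<open>Nothing is required of \<open>K z\<close> when \<open>z\<close> has probability zero.\<close>

definition is_conditional_pmf :: "('a \<times> 'z) pmf \<Rightarrow> ('z \<Rightarrow> 'a pmf) \<Rightarrow> bool" where
  "is_conditional_pmf J K \<longleftrightarrow>
     (\<forall>z \<in> set_pmf (map_pmf snd J). K z = map_pmf fst (cond_pmf J {w. snd w = z}))"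

definition kernel_product ::
  "('z \<Rightarrow> 'x pmf) \<Rightarrow> ('z \<Rightarrow> 'y pmf) \<Rightarrow> 'z pmf \<Rightarrow> ('x \<times> 'y \<times> 'z) pmf" where
  "kernel_product KX KY Q =
     do {z \<leftarrow> Q; x \<leftarrow> KX z; y \<leftarrow> KY z; return_pmf (x, y, z)}"

lemma is_conditional_pmf_iff:
  "is_conditional_pmf J K \<longleftrightarrow>
     (\<forall>z a. pmf (map_pmf snd J) z > 0 \<longrightarrow> pmf (K z) a = pmf J (a, z) / pmf (map_pmf snd J) z)"
proof -
  have "pmf (map_pmf fst (cond_pmf J {w. snd w = z})) a = pmf J (a, z) / pmf (map_pmf snd J) z"
    if z: "z \<in> set_pmf (map_pmf snd J)" for z a
  proof -
    have ne: "set_pmf J \<inter> {w. snd w = z} \<noteq> {}" using z by auto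
    have "pmf (map_pmf fst (cond_pmf J {w. snd w = z})) a
        = measure (cond_pmf J {w. snd w = z}) (fst -` {a})"
      by (simp add: pmf_map)
    also have "\<dots> = measure (cond_pmf J {w. snd w = z}) {(a, z)}"
      using ne by (intro measure_pmf.finite_measure_eq_AE) (auto simp: AE_measure_pmf_iff set_cond_pmf)
    also have "\<dots> = pmf J (a, z) / measure J {w. snd w = z}"
      using ne by (simp add: measure_pmf_single pmf_cond)
    also have "measure J {w. snd w = z} = pmf (map_pmf snd J) z"
      by (simp add: pmf_map vimage_def)
    finally show ?thesis .
  qed
  then show ?thesis
    unfolding is_conditional_pmf_def by (auto simp: pmf_eq_iff pmf_positive_iff)
qed

lemma pmf_kernel_product:
  fixes KX :: "'z \<Rightarrow> 'x pmf" and KY :: "'z \<Rightarrow> 'y pmf"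
  shows "pmf (kernel_product KX KY Q) (x, y, z) = pmf Q z * pmf (KX z) x * pmf (KY z) y"
proof -
  have inner: "pmf (do {x \<leftarrow> KX z'; y \<leftarrow> KY z'; return_pmf (x, y, z')}) (x, y, z)
      = (if z' = z then pmf (KX z) x * pmf (KY z) y else 0)" for z'
  proof -
    have eq: "do {x \<leftarrow> KX z'; y \<leftarrow> KY z'; return_pmf (x, y, z')}
        = map_pmf (\<lambda>(x, y). (x, y, z')) (pair_pmf (KX z') (KY z'))"
      by (simp add: pair_pmf_def map_bind_pmf)
    show ?thesis
    proof (cases "z' = z")
      case True
      have "inj (\<lambda>(x :: 'x, y :: 'y). (x, y, z))" by (auto simp: inj_def)
      from pmf_map_inj'[OF this, of _ "(x, y)"] show ?thesis
        unfolding eq using True by (simp add: pmf_pair)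
    next
      case False
      then show ?thesis
        unfolding eq by (auto simp: pmf_eq_0_set_pmf)
    qed
  qed
  show ?thesis
    unfolding kernel_product_def pmf_bind[of Q] inner
    by (subst integral_measure_pmf_real[of "{z}"]) (auto split: if_splits)
qed


subsection \<open>Renyi divergence and conditional mutual information\<close>

text \<open>
  For \<open>\<alpha> \<noteq> 1\<close> the dominating measure is the counting measure; the case distinction in the integrand
  realises \<open>p powr \<alpha> * 0 powr (1 - \<alpha>) = \<infinity>\<close> for \<open>\<alpha> > 1\<close> and \<open>p > 0\<close>.  The library's divergence
  is a Bochner integral, with the reference measure as its first measure argument. It is meaningless
  without absolute continuity and is \<open>0\<close> when the log-density is not integrable; the divergence
  is \<open>\<infinity>\<close> in both cases, because the negative part
  of the log-density is always integrable.
\<close>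

definition renyi_divergence :: "real \<Rightarrow> 'a pmf \<Rightarrow> 'a pmf \<Rightarrow> ereal" where
  "renyi_divergence \<alpha> P Q =
     (if \<alpha> = 1 then
        (if absolutely_continuous (measure_pmf Q) (measure_pmf P) \<and>
            integrable (measure_pmf P) (entropy_density (exp 1) (measure_pmf Q) (measure_pmf P))
         then ereal (KL_divergence (exp 1) (measure_pmf Q) (measure_pmf P))
         else \<infinity>)
      else ereal (1 / (\<alpha> - 1)) * log_ennreal
        (\<integral>\<^sup>+ a. (if \<alpha> > 1 \<and> pmf P a > 0 \<and> pmf Q a = 0 then \<infinity>
                else ennreal (pmf P a powr \<alpha> * pmf Q a powr (1 - \<alpha>))) \<partial>count_space UNIV))"

lemma renyi_divergence_1:
  assumes "set_pmf P \<subseteq> set_pmf Q"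
    and int: "integrable (measure_pmf P) (\<lambda>a. ln (pmf P a / pmf Q a))"
  shows "renyi_divergence 1 P Q = ereal (\<integral>a. ln (pmf P a / pmf Q a) \<partial>measure_pmf P)"
proof -
  let ?r = "\<lambda>a. pmf P a / pmf Q a"
  have P: "measure_pmf P = density (measure_pmf Q) (\<lambda>a. ennreal (?r a))"
  proof -
    have "density (measure_pmf Q) (\<lambda>a. ennreal (?r a)) = density (count_space UNIV) (\<lambda>a. ennreal (pmf Q a) * ennreal (?r a))"
      by (simp add: measure_pmf_eq_density[of Q] density_density_eq)
    also have "(\<lambda>a. ennreal (pmf Q a) * ennreal (?r a)) = (\<lambda>a. ennreal (pmf P a))"
      using assms(1) by (auto simp: fun_eq_iff ennreal_mult[symmetric] pmf_eq_0_set_pmf)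
    finally show ?thesis by (simp add: measure_pmf_eq_density[of P])
  qed
  have "AE a in measure_pmf Q. ennreal (?r a) = RN_deriv (measure_pmf Q) (measure_pmf P) a"
    by (rule measure_pmf.RN_deriv_unique) (use P in simp_all)
  then have "\<forall>a\<in>set_pmf Q. RN_deriv (measure_pmf Q) (measure_pmf P) a = ennreal (?r a)"
    by (auto simp: AE_measure_pmf_iff)
  then have *: "AE a in measure_pmf P. entropy_density (exp 1) (measure_pmf Q) (measure_pmf P) a = ln (?r a)"
    using assms(1) by (auto simp: AE_measure_pmf_iff entropy_density_def log_def)
  have ac: "absolutely_continuous (measure_pmf Q) (measure_pmf P)"
    unfolding P by (rule absolutely_continuousI_density) simp
  have i: "integrable (measure_pmf P) (entropy_density (exp 1) (measure_pmf Q) (measure_pmf P))"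
    using int by (subst integrable_cong_AE[OF _ _ *]) auto
  have "KL_divergence (exp 1) (measure_pmf Q) (measure_pmf P) = (\<integral>a. ln (?r a) \<partial>measure_pmf P)"
    unfolding KL_divergence_def by (rule integral_cong_AE[OF _ _ *]) auto
  with ac i show ?thesis by (simp add: renyi_divergence_def)
qed

definition cond_mutual_info ::
  "real \<Rightarrow> ('x \<times> 'y \<times> 'z) pmf \<Rightarrow> ('z \<Rightarrow> 'x pmf) \<Rightarrow> ('z \<Rightarrow> 'y pmf) \<Rightarrow> ereal" where
  "cond_mutual_info \<alpha> P KX KY = (INF Q. renyi_divergence \<alpha> P (kernel_product KX KY Q))"


subsection \<open>Hypothesis tests and error exponents\<close>

text \<open>
  A test maps \<open>n\<close> and an \<open>n\<close>-tuple (a list of length \<open>n\<close>) to \<^const>\<open>True\<close> for the alternative and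
  \<^const>\<open>False\<close> for the null; values on lists of other lengths are irrelevant.
\<close>

definition error_rate :: "nat \<Rightarrow> 'a pmf \<Rightarrow> 'a list set \<Rightarrow> ereal" where
  "error_rate n P A = - (ereal (1 / real n) * log_ennreal (emeasure (measure_pmf (replicate_pmf n P)) A))"

definition achievable ::
  "('x \<times> 'y \<times> 'z) pmf \<Rightarrow> ('z \<Rightarrow> 'x pmf) \<Rightarrow> ('z \<Rightarrow> 'y pmf) \<Rightarrow> real \<Rightarrow> real \<Rightarrow> bool" where
  "achievable P KX KY eP eQ \<longleftrightarrow>
     (\<exists>T :: nat \<Rightarrow> ('x \<times> 'y \<times> 'z) list \<Rightarrow> bool.
        liminf (\<lambda>n. error_rate n P {s. T n s}) > ereal eP \<and>
        liminf (\<lambda>n. INF Q. error_rate n (kernel_product KX KY Q) {s. \<not> T n s}) > ereal eQ)"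

definition exponent_P ::
  "('x \<times> 'y \<times> 'z) pmf \<Rightarrow> ('z \<Rightarrow> 'x pmf) \<Rightarrow> ('z \<Rightarrow> 'y pmf) \<Rightarrow> real \<Rightarrow> ereal" where
  "exponent_P P KX KY eQ = Sup (ereal ` {eP. achievable P KX KY eP eQ})"

definition exponent_Q ::
  "('x \<times> 'y \<times> 'z) pmf \<Rightarrow> ('z \<Rightarrow> 'x pmf) \<Rightarrow> ('z \<Rightarrow> 'y pmf) \<Rightarrow> real \<Rightarrow> ereal" where
  "exponent_Q P KX KY eP = Sup (ereal ` {eQ. achievable P KX KY eP eQ})"

definition convex_conjugate :: "(real \<Rightarrow> ereal) \<Rightarrow> real \<Rightarrow> ereal" where
  "convex_conjugate f l = (SUP x. ereal (l * x) - f x)"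

text \<open>
  The term \<open>I - \<alpha> / (1 - \<alpha>) * E\<close>.  At \<open>\<alpha> = 1\<close> the product is read as \<open>\<infinity>\<close>, \<open>0\<close>, \<open>-\<infinity>\<close> according
  to the sign of \<open>E\<close>, and the whole term is \<open>-\<infinity>\<close> for \<open>E > 0\<close> even if \<open>I = \<infinity>\<close>.
\<close>

definition penalized :: "real \<Rightarrow> ereal \<Rightarrow> real \<Rightarrow> ereal" where
  "penalized \<alpha> I E =
     (if \<alpha> = 1 then (if E > 0 then -\<infinity> else if E = 0 then I else I - (-\<infinity>))
      else I - ereal (\<alpha> / (1 - \<alpha>) * E))"

end

theory Submission
  imports Defs
begin

text \<open>
  Fix \<open>0 < \<alpha> < 1\<close>. The minimising \<open>Q\<close> in \<open>I_\<alpha>\<close> is \<open>Q*(z) \<propto> P(z) c(z) powr (1 / \<alpha>)\<close>, where \<open>c(z)\<close> is the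
  Hellinger integral of order \<open>\<alpha>\<close> between \<open>P(\<cdot>,\<cdot>|z)\<close> and \<open>KX z \<times> KY z\<close>. The likelihood ratio of \<open>P\<close>
  against \<open>Q*\<close> has the same \<open>\<alpha>\<close>-th moment under all alternatives supported on \<open>{z. P(z) > 0}\<close>,
  so by Markov's inequality its threshold tests are good against all \<open>Q\<close> simultaneously:
  \<open>(eP, eQ)\<close> is achievable whenever \<open>\<alpha> * eP + (1 - \<alpha>) * eQ < (1 - \<alpha>) * I_\<alpha>\<close>.
  Conversely, if an open half plane \<open>\<alpha> * eP + (1 - \<alpha>) * eQ < v\<close> is achievable, Young's inequality
  bounds the \<open>n\<close>-th power of the Hellinger integral between \<open>P\<close> and any alternative by about
  \<open>exp (- n * v)\<close>, so \<open>v \<le> (1 - \<alpha>) * I_\<alpha>\<close>. This determines the supporting lines of the achievable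
  region, hence both biconjugates. The point \<open>eP = 0\<close> of the second formula also needs
  \<open>I_1 \<le> sup {I_\<alpha> | \<alpha> < 1}\<close>, which is Fatou's lemma.
\<close>

subsection \<open>Powers and products\<close>

text \<open>Weighted AM-GM for \<open>a / p\<close> and \<open>b / q\<close>, rescaled. The free
  scales \<open>p\<close> and \<open>q\<close> will be the bounds on the two measures of a cell,
  which makes the right-hand side sharp there.\<close>

lemma young_powr:
  fixes a b p q \<alpha> :: real
  assumes "0 < \<alpha>" "\<alpha> < 1" "0 \<le> a" "0 \<le> b" "0 < p" "0 < q"
  shows "a powr \<alpha> * b powr (1 - \<alpha>) \<le> p powr \<alpha> * q powr (1 - \<alpha>) * (\<alpha> * (a / p) + (1 - \<alpha>) * (b / q))"
proof (cases "a = 0 \<or> b = 0")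
  case False
  have "(a / p) powr \<alpha> * (b / q) powr (1 - \<alpha>) \<le> \<alpha> * (a / p) + (1 - \<alpha>) * (b / q)"
    using assms False by (intro Youngs_inequality_0) auto
  then have "p powr \<alpha> * q powr (1 - \<alpha>) * ((a / p) powr \<alpha> * (b / q) powr (1 - \<alpha>))
      \<le> p powr \<alpha> * q powr (1 - \<alpha>) * (\<alpha> * (a / p) + (1 - \<alpha>) * (b / q))"
    by (intro mult_left_mono) auto
  then show ?thesis using assms by (simp add: powr_divide)
qed (use assms in auto)

lemma young_powr_1:
  fixes a \<alpha> :: real
  assumes "0 < \<alpha>" "\<alpha> < 1" "0 \<le> a"
  shows "a powr \<alpha> \<le> \<alpha> * a + (1 - \<alpha>)"
  using young_powr[of \<alpha> a 1 1 1] assms by simp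

lemma prod_list_map_powr:
  fixes f :: "'a \<Rightarrow> real"
  assumes "\<And>x. x \<in> set xs \<Longrightarrow> 0 \<le> f x"
  shows "(\<Prod>x\<leftarrow>xs. f x) powr c = (\<Prod>x\<leftarrow>xs. f x powr c)"
  using assms by (induction xs) (auto simp: powr_mult prod_list_nonneg)

lemma prod_list_map_pos:
  fixes f :: "'a \<Rightarrow> real"
  assumes "\<And>x. x \<in> set xs \<Longrightarrow> 0 < f x"
  shows "0 < (\<Prod>x\<leftarrow>xs. f x)"
  using assms by (induction xs) auto

lemma ennreal_prod_list:
  fixes f :: "'a \<Rightarrow> real"
  assumes "\<And>x. x \<in> set xs \<Longrightarrow> 0 \<le> f x"
  shows "ennreal (\<Prod>x\<leftarrow>xs. f x) = (\<Prod>x\<leftarrow>xs. ennreal (f x))"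
  using assms
proof (induction xs)
  case (Cons x xs)
  have "0 \<le> (\<Prod>x\<leftarrow>xs. f x)" using Cons.prems by (intro prod_list_nonneg) auto
  with Cons show ?case by (simp add: ennreal_mult)
qed simp

lemma nn_integral_replicate_pmf_prod_list:
  fixes f :: "'a \<Rightarrow> ennreal"
  shows "(\<integral>\<^sup>+xs. (\<Prod>x\<leftarrow>xs. f x) \<partial>replicate_pmf n p) = (\<integral>\<^sup>+x. f x \<partial>p) ^ n"
  by (induction n) (auto simp: nn_integral_cmult nn_integral_multc)

lemma pmf_replicate_pmf:
  "length xs = n \<Longrightarrow> pmf (replicate_pmf n p) xs = (\<Prod>x\<leftarrow>xs. pmf p x)"
proof (induction n arbitrary: xs)
  case (Suc n)
  then obtain y ys where xs: "xs = y # ys" "length ys = n" by (cases xs) auto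
  have "replicate_pmf (Suc n) p = map_pmf (\<lambda>(x, xs). x # xs) (pair_pmf p (replicate_pmf n p))"
    by (simp add: pair_pmf_def map_bind_pmf)
  moreover have "inj (\<lambda>(x :: 'a, xs). x # xs)" by (auto simp: inj_def)
  ultimately have "pmf (replicate_pmf (Suc n) p) (y # ys) = pmf (pair_pmf p (replicate_pmf n p)) (y, ys)"
    by (metis (no_types, lifting) case_prod_conv pmf_map_inj')
  then show ?case using Suc.IH xs by (simp add: pmf_pair)
qed auto


subsection \<open>Error rates\<close>

text \<open>Removes the logarithm, so that exponents become exponential bounds on probabilities. At
  \<open>n = 0\<close> the rate is 0 because \<open>1 / 0 = 0\<close>, hence the restriction to
  positive \<open>n\<close>.\<close>

lemma error_rate_ge_iff:
  assumes "n > 0"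
  shows "ereal e \<le> error_rate n p A \<longleftrightarrow> emeasure (replicate_pmf n p) A \<le> ennreal (exp (- (real n * e)))"
proof -
  let ?m = "measure (replicate_pmf n p) A"
  have m: "emeasure (replicate_pmf n p) A = ennreal ?m" "?m \<ge> 0"
    by (auto simp: measure_pmf.emeasure_eq_measure)
  show ?thesis
  proof (cases "?m = 0")
    case True
    with m assms show ?thesis by (simp add: error_rate_def log_ennreal_def)
  next
    case False
    then have pos: "?m > 0" by (simp add: zero_less_measure_iff)
    then have "error_rate n p A = ereal (- (1 / n * ln ?m))"
      using m by (simp add: error_rate_def log_ennreal_def)
    moreover have "e \<le> - (1 / n * ln ?m) \<longleftrightarrow> ln ?m \<le> - (real n * e)"
      using assms by (simp add: field_simps le_minus_iff)
    moreover have "\<dots> \<longleftrightarrow> ?m \<le> exp (- (real n * e))"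
      using pos by (metis exp_le_cancel_iff exp_ln)
    ultimately show ?thesis using m by simp
  qed
qed

lemma less_liminf_error_rate:
  assumes "\<And>n. n > 0 \<Longrightarrow> emeasure (replicate_pmf n p) (A n) \<le> ennreal (exp (- (real n * e)))" "e' < e"
  shows "ereal e' < liminf (\<lambda>n. error_rate n p (A n))"
proof -
  have "ereal e \<le> liminf (\<lambda>n. error_rate n p (A n))"
    by (intro Liminf_bounded eventually_mono[OF eventually_gt_at_top[of 0]])
       (use assms in \<open>simp add: error_rate_ge_iff\<close>)
  with assms(2) show ?thesis by (meson ereal_less_eq(3) less_le_trans less_ereal.simps(1))
qed

text \<open>The second bound is uniform in \<open>Q\<close> at each \<open>n\<close>, so it passes
  to the infimum inside the liminf. The slack between \<open>eP, eQ\<close> and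
  \<open>e1, e2\<close> supplies the strict inequalities in \<open>achievable\<close>.\<close>

lemma achievableI:
  assumes "\<And>n. n > 0 \<Longrightarrow> emeasure (replicate_pmf n P) {s. T n s} \<le> ennreal (exp (- (real n * e1)))"
    and "\<And>n Q. n > 0 \<Longrightarrow> emeasure (replicate_pmf n (kernel_product KX KY Q)) {s. \<not> T n s} \<le> ennreal (exp (- (real n * e2)))"
    and "eP < e1" "eQ < e2"
  shows "achievable P KX KY eP eQ"
  unfolding achievable_def
proof (intro exI[of _ T] conjI)
  show "ereal eP < liminf (\<lambda>n. error_rate n P {s. T n s})"
    using assms by (intro less_liminf_error_rate[of _ _ e1]) auto
  have "ereal e2 \<le> liminf (\<lambda>n. INF Q. error_rate n (kernel_product KX KY Q) {s. \<not> T n s})"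
    by (intro Liminf_bounded eventually_mono[OF eventually_gt_at_top[of 0]] INF_greatest)
       (use assms in \<open>simp add: error_rate_ge_iff\<close>)
  with assms(4) show "ereal eQ < liminf (\<lambda>n. INF Q. error_rate n (kernel_product KX KY Q) {s. \<not> T n s})"
    by (meson ereal_less_eq(3) less_le_trans less_ereal.simps(1))
qed

text \<open>Since the infimum over \<open>Q\<close> sits inside the liminf, one threshold on
  \<open>n\<close> serves all alternatives at once.\<close>

lemma achievableE:
  assumes "achievable P KX KY eP eQ"
  obtains T where "eventually (\<lambda>n. emeasure (replicate_pmf n P) {s. T n s} \<le> ennreal (exp (- (real n * eP)))
     \<and> (\<forall>Q. emeasure (replicate_pmf n (kernel_product KX KY Q)) {s. \<not> T n s} \<le> ennreal (exp (- (real n * eQ))))) sequentially"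
proof -
  obtain T where "ereal eP < liminf (\<lambda>n. error_rate n P {s. T n s})"
    and "ereal eQ < liminf (\<lambda>n. INF Q. error_rate n (kernel_product KX KY Q) {s. \<not> T n s})"
    using assms by (auto simp: achievable_def)
  then have "eventually (\<lambda>n. ereal eP < error_rate n P {s. T n s}) sequentially"
    "eventually (\<lambda>n. ereal eQ < (INF Q. error_rate n (kernel_product KX KY Q) {s. \<not> T n s})) sequentially"
    by (auto dest: less_LiminfD)
  then have "eventually (\<lambda>n. emeasure (replicate_pmf n P) {s. T n s} \<le> ennreal (exp (- (real n * eP)))
     \<and> (\<forall>Q. emeasure (replicate_pmf n (kernel_product KX KY Q)) {s. \<not> T n s} \<le> ennreal (exp (- (real n * eQ))))) sequentially"
    using eventually_gt_at_top[of 0]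
  proof eventually_elim
    case (elim n)
    then have "ereal eQ \<le> error_rate n (kernel_product KX KY Q) {s. \<not> T n s}" for Q
      by (meson INF_lower UNIV_I less_imp_le order_less_le_trans)
    with elim show ?case by (auto simp: error_rate_ge_iff[symmetric] less_imp_le)
  qed
  then show ?thesis by (rule that)
qed

section \<open>Monotonicity and the constant tests\<close>

lemma achievable_mono:
  assumes "achievable P KX KY eP eQ" "eP' \<le> eP" "eQ' \<le> eQ"
  shows "achievable P KX KY eP' eQ'"
  using assms unfolding achievable_def by (meson ereal_less_eq(3) le_less_trans)

text \<open>The test that always rejects never errs under the alternative, and its error of
  probability 1 under the null has exponent 0, above \<open>eP\<close>.\<close>

lemma achievable_neg_P:
  assumes "eP < 0"
  shows "achievable P KX KY eP eQ"
  by (rule achievableI[where T = "\<lambda>_ _. True" and ?e1.0 = 0 and ?e2.0 = "eQ + 1"]) (use assms in auto)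

lemma achievable_neg_Q:
  assumes "eQ < 0"
  shows "achievable P KX KY eP eQ"
  by (rule achievableI[where T = "\<lambda>_ _. False" and ?e2.0 = 0 and ?e1.0 = "eP + 1"]) (use assms in auto)

subsection \<open>The converse\<close>

definition hellinger :: "real \<Rightarrow> 'a pmf \<Rightarrow> 'a pmf \<Rightarrow> ennreal" where
  "hellinger \<alpha> p q = (\<integral>\<^sup>+x. ennreal (pmf p x powr \<alpha> * pmf q x powr (1 - \<alpha>)) \<partial>count_space UNIV)"

text \<open>Writing the integral as an expectation under \<open>q\<close> makes it multiplicative
  over independent samples. Points with \<open>pmf q x = 0\<close> contribute 0 on both sides, since
  \<open>0 powr c = 0\<close>.\<close>

lemma hellinger_eq_nn_integral:
  "hellinger \<alpha> p q = (\<integral>\<^sup>+x. ennreal ((pmf p x / pmf q x) powr \<alpha>) \<partial>q)"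
  unfolding hellinger_def nn_integral_measure_pmf
proof (intro nn_integral_cong)
  fix x
  show "ennreal (pmf p x powr \<alpha> * pmf q x powr (1 - \<alpha>)) = ennreal (pmf q x) * ennreal ((pmf p x / pmf q x) powr \<alpha>)"
    by (cases "pmf q x = 0") (auto simp: powr_divide powr_diff ennreal_mult[symmetric] field_simps)
qed

lemma renyi_divergence_less_1:
  "\<alpha> < 1 \<Longrightarrow> renyi_divergence \<alpha> p q = ereal (1 / (\<alpha> - 1)) * log_ennreal (hellinger \<alpha> p q)"
  by (simp add: renyi_divergence_def hellinger_def)

lemma nn_integral_pmf_times_indicator:
  "(\<integral>\<^sup>+x. ennreal (pmf p x) * indicator C x \<partial>count_space UNIV) = emeasure (measure_pmf p) C"
  by (simp flip: nn_integral_measure_pmf)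

text \<open>Young's inequality with scales \<open>a\<close> and \<open>b\<close> turns the integrand
  into a linear combination of the two pmfs. Integrated over \<open>C\<close>, the normalised masses
  are at most 1 and their weights add up to 1.\<close>

lemma nn_integral_young_powr:
  assumes "0 < \<alpha>" "\<alpha> < 1" "0 < a" "0 < b"
    and "emeasure (measure_pmf p) C \<le> ennreal a" "emeasure (measure_pmf q) C \<le> ennreal b"
  shows "(\<integral>\<^sup>+x. ennreal (pmf p x powr \<alpha> * pmf q x powr (1 - \<alpha>)) * indicator C x \<partial>count_space UNIV)
    \<le> ennreal (a powr \<alpha> * b powr (1 - \<alpha>))"
proof -
  let ?c = "a powr \<alpha> * b powr (1 - \<alpha>)"
  have c: "0 \<le> ?c * \<alpha> / a" "0 \<le> ?c * (1 - \<alpha>) / b" using assms by auto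
  have "(\<integral>\<^sup>+x. ennreal (pmf p x powr \<alpha> * pmf q x powr (1 - \<alpha>)) * indicator C x \<partial>count_space UNIV)
      \<le> (\<integral>\<^sup>+x. ennreal (?c * \<alpha> / a) * (ennreal (pmf p x) * indicator C x)
          + ennreal (?c * (1 - \<alpha>) / b) * (ennreal (pmf q x) * indicator C x) \<partial>count_space UNIV)"
  proof (intro nn_integral_mono)
    fix x
    have "ennreal (pmf p x powr \<alpha> * pmf q x powr (1 - \<alpha>))
        \<le> ennreal (?c * (\<alpha> * (pmf p x / a) + (1 - \<alpha>) * (pmf q x / b)))"
      using assms by (intro ennreal_leI young_powr) auto
    also have "\<dots> = ennreal (?c * \<alpha> / a * pmf p x + ?c * (1 - \<alpha>) / b * pmf q x)"
      by (simp add: algebra_simps)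
    also have "\<dots> = ennreal (?c * \<alpha> / a) * ennreal (pmf p x) + ennreal (?c * (1 - \<alpha>) / b) * ennreal (pmf q x)"
      by (simp only: ennreal_plus ennreal_mult c pmf_nonneg mult_nonneg_nonneg)
    finally show "ennreal (pmf p x powr \<alpha> * pmf q x powr (1 - \<alpha>)) * indicator C x
        \<le> ennreal (?c * \<alpha> / a) * (ennreal (pmf p x) * indicator C x)
          + ennreal (?c * (1 - \<alpha>) / b) * (ennreal (pmf q x) * indicator C x)"
      by (simp split: split_indicator)
  qed
  also have "\<dots> = ennreal (?c * \<alpha> / a) * emeasure p C + ennreal (?c * (1 - \<alpha>) / b) * emeasure q C"
    by (simp add: nn_integral_add nn_integral_cmult nn_integral_pmf_times_indicator)
  also have "\<dots> \<le> ennreal (?c * \<alpha> / a) * ennreal a + ennreal (?c * (1 - \<alpha>) / b) * ennreal b"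
    using assms by (intro add_mono mult_left_mono) auto
  also have "\<dots> = ennreal ?c"
    using assms by (simp add: ennreal_mult[symmetric] ennreal_plus[symmetric] del: ennreal_plus)
      (simp add: algebra_simps)
  finally show ?thesis .
qed

text \<open>Each cell contributes at most \<open>e\<close> by the preceding bound; overlaps of cells
  only enlarge the sum.\<close>

lemma hellinger_le_cover:
  assumes "0 < \<alpha>" "\<alpha> < 1" "finite I" "(\<Union>i\<in>I. C i) = UNIV"
    and "\<And>i. i \<in> I \<Longrightarrow> 0 < a i \<and> 0 < b i \<and> a i powr \<alpha> * b i powr (1 - \<alpha>) \<le> e"
    and "\<And>i. i \<in> I \<Longrightarrow> emeasure (measure_pmf p) (C i) \<le> ennreal (a i)"
    and "\<And>i. i \<in> I \<Longrightarrow> emeasure (measure_pmf q) (C i) \<le> ennreal (b i)"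
  shows "hellinger \<alpha> p q \<le> of_nat (card I) * ennreal e"
proof -
  let ?f = "\<lambda>x. ennreal (pmf p x powr \<alpha> * pmf q x powr (1 - \<alpha>))"
  have "hellinger \<alpha> p q \<le> (\<integral>\<^sup>+x. (\<Sum>i\<in>I. ?f x * indicator (C i) x) \<partial>count_space UNIV)"
    unfolding hellinger_def
  proof (intro nn_integral_mono)
    fix x
    obtain i where i: "i \<in> I" "x \<in> C i" using assms(4) by auto
    then have "?f x = ?f x * indicator (C i) x" by simp
    also have "\<dots> \<le> (\<Sum>i\<in>I. ?f x * indicator (C i) x)"
      using assms(3) i by (intro member_le_sum) auto
    finally show "?f x \<le> (\<Sum>i\<in>I. ?f x * indicator (C i) x)" .
  qed
  also have "\<dots> = (\<Sum>i\<in>I. \<integral>\<^sup>+x. ?f x * indicator (C i) x \<partial>count_space UNIV)"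
    by (rule nn_integral_sum) auto
  also have "\<dots> \<le> (\<Sum>i\<in>I. ennreal e)"
  proof (intro sum_mono)
    fix i assume i: "i \<in> I"
    have "(\<integral>\<^sup>+x. ?f x * indicator (C i) x \<partial>count_space UNIV) \<le> ennreal (a i powr \<alpha> * b i powr (1 - \<alpha>))"
      using assms i by (intro nn_integral_young_powr) auto
    also have "\<dots> \<le> ennreal e" using assms(5)[OF i] by (intro ennreal_leI) auto
    finally show "(\<integral>\<^sup>+x. ?f x * indicator (C i) x \<partial>count_space UNIV) \<le> ennreal e" .
  qed
  finally show ?thesis by simp
qed

lemma hellinger_le_1:
  assumes "0 < \<alpha>" "\<alpha> < 1"
  shows "hellinger \<alpha> p q \<le> 1"
  using hellinger_le_cover[OF assms, of "{()}" "\<lambda>_. UNIV" "\<lambda>_. 1" "\<lambda>_. 1" 1 p q]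
  by (simp add: measure_pmf.emeasure_space_1[simplified])

lemma hellinger_replicate_pmf:
  "hellinger \<alpha> (replicate_pmf n p) (replicate_pmf n q) = hellinger \<alpha> p q ^ n"
proof -
  have ratio: "(\<Prod>x\<leftarrow>xs. pmf p x) / (\<Prod>x\<leftarrow>xs. pmf q x) = (\<Prod>x\<leftarrow>xs. pmf p x / pmf q x)" for xs
  proof (induction xs)
    case (Cons x xs)
    have "(\<Prod>x\<leftarrow>x # xs. pmf p x) / (\<Prod>x\<leftarrow>x # xs. pmf q x)
        = pmf p x / pmf q x * ((\<Prod>x\<leftarrow>xs. pmf p x) / (\<Prod>x\<leftarrow>xs. pmf q x))" by simp
    then show ?case using Cons.IH by simp
  qed simp
  have "hellinger \<alpha> (replicate_pmf n p) (replicate_pmf n q)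
      = (\<integral>\<^sup>+xs. (\<Prod>x\<leftarrow>xs. ennreal ((pmf p x / pmf q x) powr \<alpha>)) \<partial>replicate_pmf n q)"
    unfolding hellinger_eq_nn_integral
    by (intro nn_integral_cong_AE)
       (auto simp: AE_measure_pmf_iff set_replicate_pmf pmf_replicate_pmf ratio prod_list_map_powr ennreal_prod_list)
  then show ?thesis by (simp add: nn_integral_replicate_pmf_prod_list hellinger_eq_nn_integral)
qed

text \<open>A constant factor disappears on the exponential scale: if \<open>s > e\<close>, then
  \<open>c * (e / s) ^ n\<close> tends to 0 although it should stay at least 1.\<close>

lemma le_of_power_le_mult_power:
  fixes s e :: real and c :: real
  assumes "0 < e" and "eventually (\<lambda>n. s ^ n \<le> c * e ^ n) sequentially"
  shows "s \<le> e"
proof (rule ccontr)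
  assume "\<not> s \<le> e"
  then have s: "0 < s" "norm (e / s) < 1" using assms(1) by auto
  have "(\<lambda>n. c * (e / s) ^ n) \<longlonglongrightarrow> 0"
    using tendsto_mult_right_zero[OF LIMSEQ_power_zero[OF s(2)]] .
  then have "eventually (\<lambda>n. c * (e / s) ^ n < 1) sequentially"
    by (rule order_tendstoD) simp
  with assms(2) have "eventually (\<lambda>n. False) sequentially"
  proof eventually_elim
    case (elim n)
    then show ?case using s(1) by (simp add: power_divide field_simps)
  qed
  then show False by simp
qed

text \<open>
  If the whole half plane were achievable, tests with type II exponents on a fine grid would cut
  the sample space into finitely many cells, on each of which one of the two measures is small
  enough for the Hellinger integral of the cell to be at most \<open>exp (- n * v')\<close>.
\<close>

lemma hellinger_le_of_achievable:
  assumes a: "0 < \<alpha>" "\<alpha> < 1" and v: "v' < v"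
    and ach: "\<And>eP eQ. \<alpha> * eP + (1 - \<alpha>) * eQ < v \<Longrightarrow> achievable P KX KY eP eQ"
  shows "hellinger \<alpha> P (kernel_product KX KY Q) \<le> ennreal (exp (- v'))"
proof -
  let ?Q = "kernel_product KX KY Q"
  \<comment> \<open>Half of the gap between \<open>v'\<close> and \<open>v\<close> keeps the grid
    points strictly inside the half plane; the other half, \<open>(1 - \<alpha>) * d\<close>, pays
    for one grid step. The points \<open>(y i, i * d)\<close> lie on the line of level
    \<open>u\<close>.\<close>
  define u where "u = (v + v') / 2"
  define d where "d = (v - v') / 2 / (1 - \<alpha>)"
  define y where "y i = (u - (1 - \<alpha>) * (real i * d)) / \<alpha>" for i :: nat
  have d: "d > 0" using a v by (auto simp: d_def)
  have d2: "(1 - \<alpha>) * d = (v - v') / 2"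
  proof -
    have *: "c * (w / c) = w" if "c \<noteq> 0" for c w :: real using that by simp
    show ?thesis unfolding d_def by (rule *) (use a in simp)
  qed
  have y: "\<alpha> * y i + (1 - \<alpha>) * (real i * d) = u" for i using a by (simp add: y_def)
  \<comment> \<open>The grid reaches so far that the type II exponent \<open>K * d\<close> alone
    already gives \<open>v'\<close>. The last cell then needs no bound under
    \<open>P\<close>.\<close>
  obtain K :: nat where K: "v' / (1 - \<alpha>) < real K * d"
    using d by (metis ex_less_of_nat_mult)
  have "achievable P KX KY (y i) (real i * d)" for i
    using v by (intro ach) (simp add: y u_def)
  then have "\<forall>i. \<exists>T. eventually (\<lambda>n. emeasure (replicate_pmf n P) {s. T n s} \<le> ennreal (exp (- (real n * y i)))
     \<and> (\<forall>Q. emeasure (replicate_pmf n (kernel_product KX KY Q)) {s. \<not> T n s} \<le> ennreal (exp (- (real n * (real i * d)))))) sequentially"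
    by (auto elim: achievableE)
  from choice[OF this] obtain T where T: "\<And>i. eventually (\<lambda>n. emeasure (replicate_pmf n P) {s. T i n s} \<le> ennreal (exp (- (real n * y i)))
     \<and> (\<forall>Q. emeasure (replicate_pmf n (kernel_product KX KY Q)) {s. \<not> T i n s} \<le> ennreal (exp (- (real n * (real i * d)))))) sequentially"
    by auto
  have "eventually (\<lambda>n. \<forall>i\<in>{..K}. emeasure (replicate_pmf n P) {s. T i n s} \<le> ennreal (exp (- (real n * y i)))
     \<and> (\<forall>Q. emeasure (replicate_pmf n (kernel_product KX KY Q)) {s. \<not> T i n s} \<le> ennreal (exp (- (real n * (real i * d)))))) sequentially"
    using T by (intro eventually_ball_finite) auto
  then have ev: "eventually (\<lambda>n. hellinger \<alpha> P ?Q ^ n \<le> of_nat (K + 2) * ennreal (exp (- v') ^ n)) sequentially"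
  proof eventually_elim
    case (elim n)
    \<comment> \<open>Cell \<open>i\<close> contains the samples for which \<open>i\<close> is the
      first index whose test rejects: \<open>T i\<close> bounds its mass under \<open>P\<close>, and
      acceptance by \<open>T (i - 1)\<close> bounds its mass under the alternative. Cell
      \<open>K + 1\<close> catches the samples that no test rejects. At \<open>i = 0\<close>
      truncated subtraction gives \<open>B 0 = 1\<close>, the trivial bound.\<close>
    define C where "C i = (if i \<le> K then {s. T i n s} \<inter> (if i = 0 then UNIV else {s. \<not> T (i - 1) n s}) else {s. \<not> T K n s})" for i
    define A where "A i = (if i \<le> K then exp (- (real n * y i)) else 1)" for i
    define B where "B i = exp (- (real n * (real (i - 1) * d)))" for i
    have cover: "(\<Union>i\<in>{..K + 1}. C i) = UNIV"
    proof (intro equalityI subset_UNIV subsetI)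
      fix s
      show "s \<in> (\<Union>i\<in>{..K + 1}. C i)"
      proof (cases "\<exists>i\<le>K. T i n s")
        case True
        define i where "i = (LEAST i. T i n s)"
        have i: "T i n s" "i \<le> K" unfolding i_def using True by (auto intro: LeastI Least_le le_trans)
        have "\<not> T (i - 1) n s" if "i \<noteq> 0"
          using that not_less_Least[of "i - 1" "\<lambda>i. T i n s"] unfolding i_def[symmetric] by auto
        with i have "s \<in> C i" by (auto simp: C_def)
        with i show ?thesis by auto
      next
        case False
        then have "s \<in> C (K + 1)" by (simp add: C_def)
        then show ?thesis by blast
      qed
    qed
    have "hellinger \<alpha> (replicate_pmf n P) (replicate_pmf n ?Q) \<le> of_nat (card {..K + 1}) * ennreal (exp (- (real n * v')))"
    proof (rule hellinger_le_cover[OF a _ cover])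
      fix i assume "i \<in> {..K + 1}"
      \<comment> \<open>The two exponents come from neighbouring grid points, so the level drops
        from \<open>u\<close> by at most \<open>(1 - \<alpha>) * d\<close>, that is, to
        \<open>v'\<close>.\<close>
      have "v' \<le> (if i \<le> K then \<alpha> * y i else 0) + (1 - \<alpha>) * (real (i - 1) * d)"
      proof (cases "i \<le> K")
        case True
        have "(1 - \<alpha>) * (real i * d) \<le> (1 - \<alpha>) * (real (i - 1) * d) + (1 - \<alpha>) * d"
          using a d by (cases i) (auto simp: algebra_simps)
        with y[of i] d2 True show ?thesis by (simp add: u_def field_simps)
      next
        case False
        with \<open>i \<in> {..K + 1}\<close> have "i - 1 = K" by auto
        with False K a show ?thesis by (simp add: field_simps)
      qed
      then have "real n * v' \<le> real n * ((if i \<le> K then \<alpha> * y i else 0) + (1 - \<alpha>) * (real (i - 1) * d))"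
        by (intro mult_left_mono) auto
      moreover have "A i powr \<alpha> * B i powr (1 - \<alpha>)
          = exp (- (real n * ((if i \<le> K then \<alpha> * y i else 0) + (1 - \<alpha>) * (real (i - 1) * d))))"
        by (auto simp: A_def B_def powr_def exp_add[symmetric] algebra_simps)
      ultimately show "0 < A i \<and> 0 < B i \<and> A i powr \<alpha> * B i powr (1 - \<alpha>) \<le> exp (- (real n * v'))"
        by (simp add: A_def B_def)
      show "emeasure (replicate_pmf n P) (C i) \<le> ennreal (A i)"
      proof (cases "i \<le> K")
        case True
        then have "emeasure (replicate_pmf n P) (C i) \<le> emeasure (replicate_pmf n P) {s. T i n s}"
          by (intro emeasure_mono) (auto simp: C_def)
        also have "\<dots> \<le> ennreal (A i)" using elim True by (simp add: A_def)
        finally show ?thesis .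
      qed (simp add: A_def measure_pmf.emeasure_le_1)
      show "emeasure (replicate_pmf n ?Q) (C i) \<le> ennreal (B i)"
      proof (cases "i = 0")
        case False
        then have "i - 1 \<le> K" using \<open>i \<in> {..K + 1}\<close> by auto
        have "emeasure (replicate_pmf n ?Q) (C i) \<le> emeasure (replicate_pmf n ?Q) {s. \<not> T (i - 1) n s}"
          using False \<open>i \<in> {..K + 1}\<close> by (intro emeasure_mono) (auto simp: C_def le_Suc_eq)
        also have "\<dots> \<le> ennreal (B i)" using elim \<open>i - 1 \<le> K\<close> unfolding B_def by blast
        finally show ?thesis .
      qed (simp add: B_def measure_pmf.emeasure_le_1)
    qed auto
    then show ?case by (simp add: hellinger_replicate_pmf exp_of_nat_mult[symmetric])
  qed
  define s where "s = enn2real (hellinger \<alpha> P ?Q)"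
  have s: "hellinger \<alpha> P ?Q = ennreal s" "s \<ge> 0"
    using hellinger_le_1[OF a, of P ?Q] by (auto simp: s_def less_top[symmetric] top_unique intro!: ennreal_enn2real[symmetric])
  have "s \<le> exp (- v')"
  proof (rule le_of_power_le_mult_power)
    show "eventually (\<lambda>n. s ^ n \<le> real (K + 2) * exp (- v') ^ n) sequentially"
      using ev
    proof eventually_elim
      case (elim n)
      then have "ennreal (s ^ n) \<le> ennreal (real (K + 2) * exp (- v') ^ n)"
        using s by (simp add: ennreal_power ennreal_mult ennreal_of_nat_eq_real_of_nat del: of_nat_add)
      then show ?case by (simp add: ennreal_le_iff)
    qed
  qed simp
  with s show ?thesis by (simp add: ennreal_leI)
qed

text \<open>The bound \<open>exp (- v')\<close> on the Hellinger integral holds for every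
  \<open>v' < v\<close> and every alternative. Taking \<open>- ln\<close> and dividing by
  \<open>1 - \<alpha>\<close> turns it into a bound on each divergence, hence on the
  infimum.\<close>

lemma cond_mutual_info_ge_of_achievable:
  assumes a: "0 < \<alpha>" "\<alpha> < 1"
    and ach: "\<And>eP eQ. \<alpha> * eP + (1 - \<alpha>) * eQ < v \<Longrightarrow> achievable P KX KY eP eQ"
  shows "ereal (v / (1 - \<alpha>)) \<le> cond_mutual_info \<alpha> P KX KY"
  unfolding cond_mutual_info_def
proof (intro INF_greatest)
  fix Q
  let ?h = "hellinger \<alpha> P (kernel_product KX KY Q)"
  have h: "?h \<le> ennreal (exp (- v'))" if "v' < v" for v'
    using that by (intro hellinger_le_of_achievable[OF a _ ach])
  show "ereal (v / (1 - \<alpha>)) \<le> renyi_divergence \<alpha> P (kernel_product KX KY Q)"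
  proof (cases "?h = 0")
    case True
    with a show ?thesis by (simp add: renyi_divergence_less_1 log_ennreal_def)
  next
    case False
    define s where "s = enn2real ?h"
    have fin: "?h \<noteq> \<infinity>" using hellinger_le_1[OF a, of P "kernel_product KX KY Q"] by (auto simp: top_unique)
    then have s: "?h = ennreal s" "s > 0"
      using False by (auto simp: s_def enn2real_positive_iff less_top zero_less_iff_neq_zero)
    have "v' \<le> - ln s" if "v' < v" for v'
    proof -
      have "s \<le> exp (- v')" using h[OF that] s by simp
      then have "ln s \<le> - v'" using s(2) by (metis exp_gt_zero ln_exp ln_le_cancel_iff)
      then show ?thesis by simp
    qed
    then have "v \<le> - ln s" by (rule dense_le)
    then have "v / (1 - \<alpha>) \<le> - ln s / (1 - \<alpha>)" using a by (intro divide_right_mono) auto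
    also have "\<dots> = 1 / (\<alpha> - 1) * ln s" using a by (simp add: field_simps)
    finally show ?thesis using s fin a by (simp add: renyi_divergence_less_1 log_ennreal_def)
  qed
qed

subsection \<open>The optimal score\<close>

text \<open>The conditional integral given \<open>z\<close> under the product of the two kernels.
  Values in \<open>ennreal\<close> avoid integrability conditions.\<close>

definition slice :: "('z \<Rightarrow> 'x pmf) \<Rightarrow> ('z \<Rightarrow> 'y pmf) \<Rightarrow> ('x \<times> 'y \<times> 'z \<Rightarrow> ennreal) \<Rightarrow> 'z \<Rightarrow> ennreal" where
  "slice KX KY g z = (\<integral>\<^sup>+x. \<integral>\<^sup>+y. g (x, y, z) \<partial>KY z \<partial>KX z)"

lemma nn_integral_kernel_product:
  "(\<integral>\<^sup>+w. g w \<partial>kernel_product KX KY Q) = (\<integral>\<^sup>+z. slice KX KY g z \<partial>Q)"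
  by (simp add: kernel_product_def slice_def)

lemma slice_scale: "slice KX KY (\<lambda>(x, y, z). f z * g (x, y, z)) z = f z * slice KX KY g z"
  by (simp add: slice_def nn_integral_cmult)

lemma slice_mono: "(\<And>x y. g (x, y, z) \<le> h (x, y, z)) \<Longrightarrow> slice KX KY g z \<le> slice KX KY h z"
  by (auto simp: slice_def intro!: nn_integral_mono)

lemma slice_affine:
  "slice KX KY (\<lambda>w. a * g w + b) z = a * slice KX KY g z + b"
  by (simp add: slice_def nn_integral_add nn_integral_cmult measure_pmf.emeasure_space_1[simplified])

text \<open>Markov's inequality for a product statistic, whose expectation factorises by
  independence. The lower bound is demanded only on samples within the support of \<open>p\<close>,
  because scores may vanish elsewhere.\<close>

lemma emeasure_replicate_pmf_le:
  assumes "\<And>s. s \<in> A \<Longrightarrow> set s \<subseteq> set_pmf p \<Longrightarrow> 1 \<le> c * (\<Prod>x\<leftarrow>s. f x)"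
    and "\<And>x. 0 \<le> f x" "0 \<le> c"
  shows "emeasure (replicate_pmf n p) A \<le> ennreal c * (\<integral>\<^sup>+x. ennreal (f x) \<partial>p) ^ n"
proof -
  have "emeasure (replicate_pmf n p) A = (\<integral>\<^sup>+s. indicator A s \<partial>replicate_pmf n p)" by simp
  also have "\<dots> \<le> (\<integral>\<^sup>+s. ennreal c * (\<Prod>x\<leftarrow>s. ennreal (f x)) \<partial>replicate_pmf n p)"
  proof (intro nn_integral_mono_AE, unfold AE_measure_pmf_iff, intro ballI)
    fix s assume "s \<in> set_pmf (replicate_pmf n p)"
    then have "set s \<subseteq> set_pmf p" by (auto simp: set_replicate_pmf)
    then have "indicator A s \<le> ennreal (c * (\<Prod>x\<leftarrow>s. f x))"
      using assms(1)[of s] by (auto split: split_indicator simp flip: ennreal_1 intro!: ennreal_leI)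
    then show "indicator A s \<le> ennreal c * (\<Prod>x\<leftarrow>s. ennreal (f x))"
      using assms(2,3) by (simp add: ennreal_mult'' prod_list_nonneg ennreal_prod_list ennreal_mult')
  qed
  also have "\<dots> = ennreal c * (\<integral>\<^sup>+x. ennreal (f x) \<partial>p) ^ n"
    by (simp add: nn_integral_cmult nn_integral_replicate_pmf_prod_list)
  finally show ?thesis .
qed

section \<open>Disintegration of \<open>P\<close> along the third coordinate\<close>

locale conditional_kernels =
  fixes P :: "('x \<times> 'y \<times> 'z) pmf" and KX :: "'z \<Rightarrow> 'x pmf" and KY :: "'z \<Rightarrow> 'y pmf"
  assumes KX: "is_conditional_pmf (map_pmf (\<lambda>(x, y, z). (x, z)) P) KX"
    and KY: "is_conditional_pmf (map_pmf (\<lambda>(x, y, z). (y, z)) P) KY"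
begin

definition PZ :: "'z pmf" where "PZ = map_pmf (\<lambda>(x, y, z). z) P"

text \<open>The alternative that shares the third marginal of \<open>P\<close>. It dominates
  \<open>P\<close> and serves as reference measure.\<close>

definition M :: "('x \<times> 'y \<times> 'z) pmf" where "M = kernel_product KX KY PZ"

definition dens :: "'x \<times> 'y \<times> 'z \<Rightarrow> real" where "dens w = pmf P w / pmf M w"

lemma dens_nonneg [simp]: "0 \<le> dens w"
  by (simp add: dens_def)

text \<open>A point charged by \<open>P\<close> has positive mass in both pair marginals, so both
  kernels charge its coordinates.\<close>

lemma set_P_subset_M: "set_pmf P \<subseteq> set_pmf M"
proof
  fix w assume w: "w \<in> set_pmf P"
  obtain x y z where xyz: "w = (x, y, z)" by (cases w)
  have PZ1: "map_pmf snd (map_pmf (\<lambda>(x, y, z). (x, z)) P) = PZ"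
    and PZ2: "map_pmf snd (map_pmf (\<lambda>(x, y, z). (y, z)) P) = PZ"
    by (auto simp: PZ_def pmf.map_comp intro!: pmf.map_cong0)
  have z: "z \<in> set_pmf PZ" using w by (force simp: PZ_def xyz)
  then have "pmf (KX z) x = pmf (map_pmf (\<lambda>(x, y, z). (x, z)) P) (x, z) / pmf PZ z"
    "pmf (KY z) y = pmf (map_pmf (\<lambda>(x, y, z). (y, z)) P) (y, z) / pmf PZ z"
    using KX KY unfolding is_conditional_pmf_iff PZ1 PZ2 by (auto simp: pmf_positive_iff)
  moreover have "(x, z) \<in> set_pmf (map_pmf (\<lambda>(x, y, z). (x, z)) P)" "(y, z) \<in> set_pmf (map_pmf (\<lambda>(x, y, z). (y, z)) P)"
    using w by (force simp: xyz)+
  ultimately have "pmf PZ z * pmf (KX z) x * pmf (KY z) y > 0"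
    using z by (metis divide_pos_pos mult_pos_pos pmf_positive)
  then show "w \<in> set_pmf M" by (simp add: xyz M_def pmf_kernel_product flip: pmf_positive_iff)
qed

lemma pmf_P_eq: "pmf P w = pmf M w * dens w"
proof (cases "w \<in> set_pmf M")
  case False
  with set_P_subset_M have "pmf P w = 0" "pmf M w = 0" by (auto simp: pmf_eq_0_set_pmf)
  then show ?thesis by simp
qed (simp add: dens_def set_pmf_eq)

lemma dens_pos_iff: "0 < dens w \<longleftrightarrow> w \<in> set_pmf P"
  using pmf_P_eq[of w] dens_nonneg[of w] by (auto simp: set_pmf_eq dens_def less_le)

lemma nn_integral_P: "(\<integral>\<^sup>+w. g w \<partial>P) = (\<integral>\<^sup>+w. ennreal (dens w) * g w \<partial>M)"
  unfolding nn_integral_measure_pmf pmf_P_eq by (simp add: ennreal_mult mult.assoc)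

lemma nn_integral_M: "(\<integral>\<^sup>+w. g w \<partial>M) = (\<integral>\<^sup>+z. slice KX KY g z \<partial>PZ)"
  by (simp add: M_def nn_integral_kernel_product)

text \<open>\<open>P\<close> and \<open>M\<close> have the same third marginal. Comparing the mass
  of \<open>{z}\<close> under both and cancelling \<open>pmf PZ z\<close> shows that
  \<open>dens\<close> is a conditional probability density on the slice.\<close>

lemma slice_dens:
  assumes "z \<in> set_pmf PZ"
  shows "slice KX KY (\<lambda>w. ennreal (dens w)) z = 1"
proof -
  have "ennreal (pmf PZ z) = (\<integral>\<^sup>+z'. indicator {z} z' \<partial>PZ)"
    by (simp add: emeasure_pmf_single)
  also have "\<dots> = (\<integral>\<^sup>+w. (case w of (x, y, z') \<Rightarrow> indicator {z} z') \<partial>P)"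
    by (simp add: PZ_def split_beta)
  also have "\<dots> = (\<integral>\<^sup>+w. (case w of (x, y, z') \<Rightarrow> indicator {z} z' * ennreal (dens (x, y, z'))) \<partial>M)"
    unfolding nn_integral_P by (intro nn_integral_cong) (auto simp: mult.commute split: prod.split)
  also have "\<dots> = (\<integral>\<^sup>+z'. indicator {z} z' * slice KX KY (\<lambda>w. ennreal (dens w)) z' \<partial>PZ)"
    unfolding nn_integral_M
    by (rule nn_integral_cong, rule slice_scale[where g = "\<lambda>w. ennreal (dens w)"])
  also have "\<dots> = (\<integral>\<^sup>+z'. slice KX KY (\<lambda>w. ennreal (dens w)) z * indicator {z} z' \<partial>PZ)"
    by (intro nn_integral_cong) (auto split: split_indicator)
  also have "\<dots> = slice KX KY (\<lambda>w. ennreal (dens w)) z * ennreal (pmf PZ z)"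
    by (simp add: nn_integral_cmult emeasure_pmf_single)
  finally have "ennreal (pmf PZ z) = slice KX KY (\<lambda>w. ennreal (dens w)) z * ennreal (pmf PZ z)" .
  moreover have "ennreal (pmf PZ z) / ennreal (pmf PZ z) = 1" "ennreal (pmf PZ z) \<noteq> 0"
    using assms by (auto simp: set_pmf_eq ennreal_divide_self less_le pmf_nonneg)
  ultimately show ?thesis
    by (metis ennreal_neq_top mult_divide_eq_ennreal)
qed

text \<open>The quantity \<open>c(z)\<close> of the overview. For orders between 0 and 1, the
  passage to reals loses nothing on the support of \<open>PZ\<close>, where the slice integral is at
  most 1.\<close>

definition cond_hellinger :: "real \<Rightarrow> 'z \<Rightarrow> real" where
  "cond_hellinger \<alpha> z = enn2real (slice KX KY (\<lambda>w. ennreal (dens w powr \<alpha>)) z)"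

section \<open>Moments of the score at a fixed order between 0 and 1\<close>

context
  fixes \<alpha> :: real
  assumes \<alpha>: "0 < \<alpha>" "\<alpha> < 1"
begin

lemma slice_powr_le:
  assumes "z \<in> set_pmf PZ"
  shows "slice KX KY (\<lambda>w. ennreal (dens w powr \<alpha>)) z \<le> 1"
proof -
  have "slice KX KY (\<lambda>w. ennreal (dens w powr \<alpha>)) z
      \<le> slice KX KY (\<lambda>w. ennreal \<alpha> * ennreal (dens w) + ennreal (1 - \<alpha>)) z"
    using \<alpha> young_powr_1[OF \<alpha>, OF dens_nonneg]
    by (intro slice_mono) (simp add: ennreal_mult[symmetric] ennreal_plus[symmetric] del: ennreal_plus)
  also have "\<dots> = ennreal \<alpha> * 1 + ennreal (1 - \<alpha>)"
    by (simp add: slice_affine slice_dens[OF assms])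
  also have "\<dots> = 1" using \<alpha> by (simp add: ennreal_plus[symmetric] del: ennreal_plus)
  finally show ?thesis .
qed

text \<open>A vanishing moment would force \<open>dens\<close> to vanish almost everywhere on the
  slice, against its total mass 1.\<close>

lemma slice_powr_pos:
  assumes "z \<in> set_pmf PZ"
  shows "slice KX KY (\<lambda>w. ennreal (dens w powr \<alpha>)) z \<noteq> 0"
proof
  assume "slice KX KY (\<lambda>w. ennreal (dens w powr \<alpha>)) z = 0"
  then have "\<forall>x\<in>set_pmf (KX z). \<forall>y\<in>set_pmf (KY z). dens (x, y, z) = 0"
    by (auto simp: slice_def nn_integral_0_iff_AE AE_measure_pmf_iff)
  then have "slice KX KY (\<lambda>w. ennreal (dens w)) z = 0"
    by (auto simp: slice_def nn_integral_0_iff_AE AE_measure_pmf_iff)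
  with slice_dens[OF assms] show False by simp
qed

lemma cond_hellinger:
  assumes "z \<in> set_pmf PZ"
  shows "slice KX KY (\<lambda>w. ennreal (dens w powr \<alpha>)) z = ennreal (cond_hellinger \<alpha> z)"
    "0 < cond_hellinger \<alpha> z" "cond_hellinger \<alpha> z \<le> 1"
proof -
  have le: "slice KX KY (\<lambda>w. ennreal (dens w powr \<alpha>)) z \<le> 1" by (rule slice_powr_le[OF assms])
  then have lt: "slice KX KY (\<lambda>w. ennreal (dens w powr \<alpha>)) z < top"
    using ennreal_one_less_top le_less_trans by blast
  then show eq: "slice KX KY (\<lambda>w. ennreal (dens w powr \<alpha>)) z = ennreal (cond_hellinger \<alpha> z)"
    by (simp add: cond_hellinger_def)
  show "0 < cond_hellinger \<alpha> z"
    using slice_powr_pos[OF assms] lt by (simp add: cond_hellinger_def enn2real_positive_iff zero_less_iff_neq_zero)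
  show "cond_hellinger \<alpha> z \<le> 1" using le unfolding eq by simp
qed

text \<open>The normalising constant of \<open>Q*\<close>; the minimal divergence turns out to be
  \<open>\<alpha> / (1 - \<alpha>)\<close> times its negative logarithm.\<close>

definition normalizer :: real where "normalizer = measure_pmf.expectation PZ (\<lambda>z. cond_hellinger \<alpha> z powr (1 / \<alpha>))"

lemma cond_hellinger_powr_le:
  "z \<in> set_pmf PZ \<Longrightarrow> cond_hellinger \<alpha> z powr (1 / \<alpha>) \<le> cond_hellinger \<alpha> z"
  using powr_mono'[of 1 "1 / \<alpha>" "cond_hellinger \<alpha> z"] cond_hellinger[of z] \<alpha> by simp

lemma integrable_cond_hellinger: "integrable PZ (\<lambda>z. cond_hellinger \<alpha> z powr (1 / \<alpha>))"
proof (rule measure_pmf.integrable_const_bound)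
  show "AE z in PZ. norm (cond_hellinger \<alpha> z powr (1 / \<alpha>)) \<le> 1"
    unfolding AE_measure_pmf_iff using cond_hellinger_powr_le cond_hellinger(3) by (auto intro: order_trans)
qed simp

lemma normalizer: "ennreal normalizer = (\<integral>\<^sup>+z. ennreal (cond_hellinger \<alpha> z powr (1 / \<alpha>)) \<partial>PZ)"
  unfolding normalizer_def by (rule nn_integral_eq_integral[symmetric]) (auto intro: integrable_cond_hellinger)

lemma normalizer_pos: "0 < normalizer"
proof -
  have "ennreal normalizer \<noteq> 0"
    unfolding normalizer using cond_hellinger(2) set_pmf_not_empty[of PZ]
    by (auto simp: nn_integral_0_iff_AE AE_measure_pmf_iff)
      (metis ex_in_conv less_irrefl)
  moreover have "0 \<le> normalizer" unfolding normalizer_def by (rule integral_nonneg_AE) auto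
  ultimately show ?thesis by (auto simp: less_le)
qed

text \<open>
  For every \<open>Q\<close> the \<open>\<alpha>\<close>-th moment of this score is at most 1; the score is a multiple of the likelihood
  ratio of \<open>P\<close> against the least favourable alternative \<open>least_favourable\<close> below.
\<close>

definition score :: "'x \<times> 'y \<times> 'z \<Rightarrow> real" where
  "score = (\<lambda>(x, y, z). dens (x, y, z) * cond_hellinger \<alpha> z powr (- 1 / \<alpha>))"

lemma score_nonneg [simp]: "0 \<le> score w"
  by (auto simp: score_def split: prod.split)

lemma score_pos: "w \<in> set_pmf P \<Longrightarrow> 0 < score w"
proof -
  assume w: "w \<in> set_pmf P"
  obtain x y z where xyz: "w = (x, y, z)" by (cases w)
  have "z \<in> set_pmf PZ" using w by (force simp: PZ_def xyz)
  then show ?thesis using w cond_hellinger(2)[of z] by (simp add: score_def xyz dens_pos_iff)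
qed

text \<open>The exponent \<open>- 1 / \<alpha>\<close> in \<open>score\<close> makes the moment on
  each slice in the support of \<open>PZ\<close> equal to \<open>c(z) powr - 1 * c(z) = 1\<close>.
  On the other slices \<open>score\<close> is 0. The weights that \<open>Q\<close> gives to the
  slices are therefore irrelevant.\<close>

lemma moment_score_alternative:
  "(\<integral>\<^sup>+w. ennreal (score w powr \<alpha>) \<partial>kernel_product KX KY Q) \<le> 1"
proof -
  have "slice KX KY (\<lambda>w. ennreal (score w powr \<alpha>)) z \<le> 1" for z
  proof (cases "z \<in> set_pmf PZ")
    case True
    note c = cond_hellinger[OF True]
    have "(\<lambda>w. ennreal (score w powr \<alpha>)) = (\<lambda>(x, y, z). ennreal (cond_hellinger \<alpha> z powr - 1) * ennreal (dens (x, y, z) powr \<alpha>))"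
      using \<alpha> by (auto simp: fun_eq_iff score_def powr_mult powr_powr ennreal_mult[symmetric] mult.commute)
    then have "slice KX KY (\<lambda>w. ennreal (score w powr \<alpha>)) z
        = ennreal (cond_hellinger \<alpha> z powr - 1) * ennreal (cond_hellinger \<alpha> z)"
      by (simp only: slice_scale[where g = "\<lambda>w. ennreal (dens w powr \<alpha>)"] c(1))
    also have "\<dots> = 1" using c(2) by (simp add: ennreal_mult[symmetric] powr_minus)
    finally show ?thesis by simp
  next
    case False
    have "score (x, y, z) = 0" for x y
    proof -
      have "(x, y, z) \<notin> set_pmf P" using False by (force simp: PZ_def)
      then have "dens (x, y, z) = 0" by (simp add: dens_def set_pmf_eq)
      then show ?thesis by (simp add: score_def)
    qed
    then show ?thesis by (simp add: slice_def)
  qed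
  then have "(\<integral>\<^sup>+w. ennreal (score w powr \<alpha>) \<partial>kernel_product KX KY Q) \<le> (\<integral>\<^sup>+z. 1 \<partial>Q)"
    unfolding nn_integral_kernel_product by (intro nn_integral_mono)
  then show ?thesis by (simp add: measure_pmf.emeasure_space_1[simplified])
qed

text \<open>Integrating out \<open>x\<close> and \<open>y\<close> contributes one factor
  \<open>c(z)\<close>, and \<open>(1 - \<alpha>) / \<alpha> + 1 = 1 / \<alpha>\<close>. Both the
  null moment of the score and the Hellinger integral against \<open>Q*\<close> reduce to this
  integral.\<close>

lemma nn_integral_M_tilted:
  "(\<integral>\<^sup>+(x, y, z). ennreal (cond_hellinger \<alpha> z powr ((1 - \<alpha>) / \<alpha>)) * ennreal (dens (x, y, z) powr \<alpha>) \<partial>M) = ennreal normalizer"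
proof -
  have "(\<integral>\<^sup>+(x, y, z). ennreal (cond_hellinger \<alpha> z powr ((1 - \<alpha>) / \<alpha>)) * ennreal (dens (x, y, z) powr \<alpha>) \<partial>M)
      = (\<integral>\<^sup>+z. ennreal (cond_hellinger \<alpha> z powr ((1 - \<alpha>) / \<alpha>)) * slice KX KY (\<lambda>w. ennreal (dens w powr \<alpha>)) z \<partial>PZ)"
    unfolding nn_integral_M
    by (rule nn_integral_cong, rule slice_scale[where g = "\<lambda>w. ennreal (dens w powr \<alpha>)"])
  also have "\<dots> = (\<integral>\<^sup>+z. ennreal (cond_hellinger \<alpha> z powr (1 / \<alpha>)) \<partial>PZ)"
  proof (intro nn_integral_cong_AE, unfold AE_measure_pmf_iff, intro ballI)
    fix z assume z: "z \<in> set_pmf PZ"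
    note c = cond_hellinger[OF z]
    have "cond_hellinger \<alpha> z powr ((1 - \<alpha>) / \<alpha>) * cond_hellinger \<alpha> z = cond_hellinger \<alpha> z powr ((1 - \<alpha>) / \<alpha> + 1)"
      using c(2) by (simp add: powr_add)
    also have "(1 - \<alpha>) / \<alpha> + 1 = 1 / \<alpha>" using \<alpha> by (simp add: field_simps)
    finally show "ennreal (cond_hellinger \<alpha> z powr ((1 - \<alpha>) / \<alpha>)) * slice KX KY (\<lambda>w. ennreal (dens w powr \<alpha>)) z
        = ennreal (cond_hellinger \<alpha> z powr (1 / \<alpha>))"
      using c by (simp add: ennreal_mult[symmetric])
  qed
  finally show ?thesis by (simp add: normalizer)
qed

lemma moment_score_null:
  "(\<integral>\<^sup>+w. ennreal (score w powr (\<alpha> - 1)) \<partial>P) = ennreal normalizer"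
proof -
  have "ennreal (dens w) * ennreal (score w powr (\<alpha> - 1))
      = (case w of (x, y, z) \<Rightarrow> ennreal (cond_hellinger \<alpha> z powr ((1 - \<alpha>) / \<alpha>)) * ennreal (dens (x, y, z) powr \<alpha>))" for w
  proof -
    obtain x y z where xyz: "w = (x, y, z)" by (cases w)
    have "dens w * dens w powr (\<alpha> - 1) = dens w powr \<alpha>"
      by (cases "dens w = 0") (auto simp: powr_diff)
    moreover have "- 1 / \<alpha> * (\<alpha> - 1) = (1 - \<alpha>) / \<alpha>" using \<alpha> by (simp add: field_simps)
    ultimately show ?thesis
      by (simp add: xyz score_def powr_mult powr_powr ennreal_mult[symmetric] mult.assoc[symmetric])
  qed
  then show ?thesis unfolding nn_integral_P by (simp add: nn_integral_M_tilted)
qed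

text \<open>Markov's inequality with the negative power \<open>\<alpha> - 1\<close>, which is large
  where the score is small. It relies on the score being positive on the support of
  \<open>P\<close>.\<close>

lemma error_null:
  "emeasure (replicate_pmf n P) {s. (\<Prod>w\<leftarrow>s. score w) \<le> exp (real n * \<tau>)}
    \<le> ennreal (exp (- (real n * (- (1 - \<alpha>) * \<tau> - ln normalizer))))"
proof -
  have "emeasure (replicate_pmf n P) {s. (\<Prod>w\<leftarrow>s. score w) \<le> exp (real n * \<tau>)}
      \<le> ennreal (exp (real n * \<tau>) powr (1 - \<alpha>)) * (\<integral>\<^sup>+w. ennreal (score w powr (\<alpha> - 1)) \<partial>P) ^ n"
  proof (rule emeasure_replicate_pmf_le)
    fix s assume s: "s \<in> {s. (\<Prod>w\<leftarrow>s. score w) \<le> exp (real n * \<tau>)}" "set s \<subseteq> set_pmf P"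
    have pos: "0 < (\<Prod>w\<leftarrow>s. score w)" using s(2) by (intro prod_list_map_pos score_pos) auto
    have "1 = (\<Prod>w\<leftarrow>s. score w) powr (1 - \<alpha>) * (\<Prod>w\<leftarrow>s. score w) powr (\<alpha> - 1)"
      using pos by (simp flip: powr_add)
    also have "\<dots> \<le> exp (real n * \<tau>) powr (1 - \<alpha>) * (\<Prod>w\<leftarrow>s. score w) powr (\<alpha> - 1)"
      using s(1) pos \<alpha> by (intro mult_right_mono powr_mono2) auto
    finally show "1 \<le> exp (real n * \<tau>) powr (1 - \<alpha>) * (\<Prod>w\<leftarrow>s. score w powr (\<alpha> - 1))"
      by (simp add: prod_list_map_powr)
  qed auto
  also have "\<dots> = ennreal (exp (real n * \<tau>) powr (1 - \<alpha>) * normalizer ^ n)"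
    using normalizer_pos by (simp add: moment_score_null ennreal_mult ennreal_power)
  also have "exp (real n * \<tau>) powr (1 - \<alpha>) * normalizer ^ n = exp (- (real n * (- (1 - \<alpha>) * \<tau> - ln normalizer)))"
  proof -
    have "normalizer ^ n = exp (real n * ln normalizer)" using normalizer_pos by (simp add: exp_of_nat_mult)
    then show ?thesis by (simp add: powr_def exp_add[symmetric] algebra_simps)
  qed
  finally show ?thesis .
qed

lemma error_alternative:
  "emeasure (replicate_pmf n (kernel_product KX KY Q)) {s. \<not> (\<Prod>w\<leftarrow>s. score w) \<le> exp (real n * \<tau>)}
    \<le> ennreal (exp (- (real n * (\<alpha> * \<tau>))))"
proof -
  have "emeasure (replicate_pmf n (kernel_product KX KY Q)) {s. \<not> (\<Prod>w\<leftarrow>s. score w) \<le> exp (real n * \<tau>)}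
      \<le> ennreal (exp (- (real n * (\<alpha> * \<tau>)))) * (\<integral>\<^sup>+w. ennreal (score w powr \<alpha>) \<partial>kernel_product KX KY Q) ^ n"
  proof (rule emeasure_replicate_pmf_le)
    fix s assume s: "s \<in> {s. \<not> (\<Prod>w\<leftarrow>s. score w) \<le> exp (real n * \<tau>)}"
    have "1 = exp (- (real n * (\<alpha> * \<tau>))) * exp (real n * \<tau>) powr \<alpha>"
      by (simp add: powr_def exp_add[symmetric])
    also have "\<dots> \<le> exp (- (real n * (\<alpha> * \<tau>))) * (\<Prod>w\<leftarrow>s. score w) powr \<alpha>"
      using s \<alpha> by (intro mult_left_mono powr_mono2) auto
    finally show "1 \<le> exp (- (real n * (\<alpha> * \<tau>))) * (\<Prod>w\<leftarrow>s. score w powr \<alpha>)"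
      by (simp add: prod_list_map_powr)
  qed auto
  also have "\<dots> \<le> ennreal (exp (- (real n * (\<alpha> * \<tau>)))) * 1 ^ n"
    by (intro mult_left_mono power_mono moment_score_alternative) auto
  finally show ?thesis by simp
qed

text \<open>With threshold \<open>\<tau>\<close> the exponents are
  \<open>- (1 - \<alpha>) * \<tau> - ln normalizer\<close> and \<open>\<alpha> * \<tau>\<close>. The
  hypothesis says exactly that some \<open>\<tau>\<close> makes them exceed \<open>eP\<close> and
  \<open>eQ\<close>.\<close>

lemma achievable_below:
  assumes "\<alpha> * eP + (1 - \<alpha>) * eQ < - \<alpha> * ln normalizer"
  shows "achievable P KX KY eP eQ"
proof -
  have "eQ / \<alpha> < (- ln normalizer - eP) / (1 - \<alpha>)"
    using assms \<alpha> by (simp add: field_simps)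
  then obtain \<tau> where \<tau>: "eQ / \<alpha> < \<tau>" "\<tau> < (- ln normalizer - eP) / (1 - \<alpha>)"
    using dense by blast
  show ?thesis
    by (rule achievableI[OF error_null error_alternative, of _ \<tau>]) (use \<tau> \<alpha> in \<open>simp_all add: field_simps\<close>)
qed

section \<open>The least favourable alternative and the value of the minimal divergence\<close>

lemma least_favourable_sum:
  "(\<integral>\<^sup>+z. ennreal (pmf PZ z * cond_hellinger \<alpha> z powr (1 / \<alpha>) / normalizer) \<partial>count_space UNIV) = 1"
proof -
  have "(\<integral>\<^sup>+z. ennreal (pmf PZ z * cond_hellinger \<alpha> z powr (1 / \<alpha>) / normalizer) \<partial>count_space UNIV)
      = (\<integral>\<^sup>+z. ennreal (1 / normalizer) * (ennreal (pmf PZ z) * ennreal (cond_hellinger \<alpha> z powr (1 / \<alpha>))) \<partial>count_space UNIV)"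
    using normalizer_pos by (intro nn_integral_cong) (simp add: ennreal_mult[symmetric])
  also have "\<dots> = ennreal (1 / normalizer) * ennreal normalizer"
    by (simp add: nn_integral_cmult normalizer nn_integral_measure_pmf)
  also have "\<dots> = 1" using normalizer_pos by (simp add: ennreal_mult[symmetric])
  finally show ?thesis .
qed

definition least_favourable :: "'z pmf" where
  "least_favourable = embed_pmf (\<lambda>z. pmf PZ z * cond_hellinger \<alpha> z powr (1 / \<alpha>) / normalizer)"

lemma pmf_least_favourable:
  "pmf least_favourable z = pmf PZ z * cond_hellinger \<alpha> z powr (1 / \<alpha>) / normalizer"
  unfolding least_favourable_def using normalizer_pos
  by (intro pmf_embed_pmf least_favourable_sum) (simp add: zero_le_divide_iff)

lemma hellinger_least_favourable:
  "hellinger \<alpha> P (kernel_product KX KY least_favourable) = ennreal (normalizer powr \<alpha>)"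
proof -
  let ?g = "\<lambda>(x, y, z). ennreal (cond_hellinger \<alpha> z powr ((1 - \<alpha>) / \<alpha>)) * ennreal (dens (x, y, z) powr \<alpha>)"
  have "ennreal (pmf P w powr \<alpha> * pmf (kernel_product KX KY least_favourable) w powr (1 - \<alpha>))
      = ennreal (normalizer powr (\<alpha> - 1)) * (ennreal (pmf M w) * ?g w)" for w
  proof -
    obtain x y z where xyz: "w = (x, y, z)" by (cases w)
    let ?c = "cond_hellinger \<alpha> z"
    have "pmf (kernel_product KX KY least_favourable) w = pmf M w * (?c powr (1 / \<alpha>) / normalizer)"
      by (simp add: xyz M_def pmf_kernel_product pmf_least_favourable)
    moreover have "(?c powr (1 / \<alpha>) / normalizer) powr (1 - \<alpha>) = ?c powr ((1 - \<alpha>) / \<alpha>) * normalizer powr (\<alpha> - 1)"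
      using normalizer_pos powr_minus_divide[of normalizer "1 - \<alpha>"] by (simp add: powr_divide powr_powr)
    ultimately have "pmf (kernel_product KX KY least_favourable) w powr (1 - \<alpha>)
        = pmf M w powr (1 - \<alpha>) * (?c powr ((1 - \<alpha>) / \<alpha>) * normalizer powr (\<alpha> - 1))"
      by (simp only: powr_mult)
    moreover have "pmf P w powr \<alpha> = pmf M w powr \<alpha> * dens w powr \<alpha>"
      by (simp add: pmf_P_eq powr_mult)
    ultimately have "pmf P w powr \<alpha> * pmf (kernel_product KX KY least_favourable) w powr (1 - \<alpha>)
        = normalizer powr (\<alpha> - 1) * ((pmf M w powr \<alpha> * pmf M w powr (1 - \<alpha>)) * (?c powr ((1 - \<alpha>) / \<alpha>) * dens w powr \<alpha>))"
      by (simp only: mult_ac)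
    also have "pmf M w powr \<alpha> * pmf M w powr (1 - \<alpha>) = pmf M w"
      by (cases "pmf M w = 0") (simp_all flip: powr_add)
    finally show ?thesis by (simp add: xyz ennreal_mult)
  qed
  then have "hellinger \<alpha> P (kernel_product KX KY least_favourable)
      = ennreal (normalizer powr (\<alpha> - 1)) * (\<integral>\<^sup>+w. ?g w \<partial>M)"
    unfolding hellinger_def by (simp add: nn_integral_cmult nn_integral_measure_pmf)
  also have "\<dots> = ennreal (normalizer powr (\<alpha> - 1) * normalizer)"
    using normalizer_pos by (simp add: nn_integral_M_tilted ennreal_mult)
  also have "normalizer powr (\<alpha> - 1) * normalizer = normalizer powr \<alpha>"
    using normalizer_pos by (simp add: powr_diff)
  finally show ?thesis .
qed

text \<open>The least favourable alternative gives the upper bound. The lower bound needs no direct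
  minimisation over \<open>Q\<close>: the half plane reached by the threshold tests is fed into the
  converse.\<close>

lemma cond_mutual_info_eq:
  "cond_mutual_info \<alpha> P KX KY = ereal (\<alpha> / (1 - \<alpha>) * - ln normalizer)"
proof (rule antisym)
  have "cond_mutual_info \<alpha> P KX KY \<le> renyi_divergence \<alpha> P (kernel_product KX KY least_favourable)"
    unfolding cond_mutual_info_def by (rule INF_lower) simp
  also have "\<dots> = ereal (1 / (\<alpha> - 1) * (\<alpha> * ln normalizer))"
    using \<alpha> normalizer_pos by (simp add: renyi_divergence_less_1 hellinger_least_favourable log_ennreal_def ln_powr)
  also have "1 / (\<alpha> - 1) * (\<alpha> * ln normalizer) = \<alpha> / (1 - \<alpha>) * - ln normalizer"
    using \<alpha> by (simp add: field_simps)
  finally show "cond_mutual_info \<alpha> P KX KY \<le> ereal (\<alpha> / (1 - \<alpha>) * - ln normalizer)" .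
  have "ereal (- \<alpha> * ln normalizer / (1 - \<alpha>)) \<le> cond_mutual_info \<alpha> P KX KY"
    by (rule cond_mutual_info_ge_of_achievable[OF \<alpha> achievable_below])
  then show "ereal (\<alpha> / (1 - \<alpha>) * - ln normalizer) \<le> cond_mutual_info \<alpha> P KX KY" by simp
qed

text \<open>Achievability and converse together identify the support function of the achievable
  region in the direction \<open>(\<alpha>, 1 - \<alpha>)\<close>, including its finiteness.\<close>

lemma all_achievable_iff:
  "\<exists>i. cond_mutual_info \<alpha> P KX KY = ereal i \<and>
    (\<forall>v. (\<forall>eP eQ. \<alpha> * eP + (1 - \<alpha>) * eQ < v \<longrightarrow> achievable P KX KY eP eQ) \<longleftrightarrow> v \<le> (1 - \<alpha>) * i)"
proof (intro exI conjI allI iffI impI)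
  let ?i = "\<alpha> / (1 - \<alpha>) * - ln normalizer"
  show eq: "cond_mutual_info \<alpha> P KX KY = ereal ?i" by (rule cond_mutual_info_eq)
  have i: "(1 - \<alpha>) * ?i = - \<alpha> * ln normalizer" using \<alpha> by simp
  {
    fix v assume "\<forall>eP eQ. \<alpha> * eP + (1 - \<alpha>) * eQ < v \<longrightarrow> achievable P KX KY eP eQ"
    then have "ereal (v / (1 - \<alpha>)) \<le> ereal ?i"
      unfolding eq[symmetric] by (intro cond_mutual_info_ge_of_achievable[OF \<alpha>]) auto
    then have "v / (1 - \<alpha>) \<le> ?i" by simp
    then show "v \<le> (1 - \<alpha>) * ?i" using \<alpha> by (subst (asm) pos_divide_le_eq) (auto simp: mult.commute)
  next
    fix v eP eQ assume "v \<le> (1 - \<alpha>) * ?i" "\<alpha> * eP + (1 - \<alpha>) * eQ < v"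
    then show "achievable P KX KY eP eQ" unfolding i by (intro achievable_below) simp
  }
qed

end

end


subsection \<open>The limit of order one\<close>

text \<open>For \<open>t > 0\<close> the rescaled gap in Young's inequality contains the difference
  quotient of \<open>a \<mapsto> t powr a\<close> at 1, whose limit is \<open>t * ln t\<close>. At
  \<open>t = 0\<close> both sides tend to 1, as \<open>0 * ln 0 = 0\<close>.\<close>

lemma young_gap_tendsto:
  fixes t :: real and a :: "nat \<Rightarrow> real"
  assumes "0 \<le> t" and a: "a \<longlonglongrightarrow> 1" "\<And>n. a n \<noteq> 1"
  shows "(\<lambda>n. a n / (1 - a n) * (a n * t + (1 - a n) - t powr a n)) \<longlonglongrightarrow> t * ln t - t + 1"
proof (cases "t = 0")
  case True
  have "a n / (1 - a n) * (1 - a n) = a n" for n using a(2)[of n] by simp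
  then show ?thesis using True a(1) by (simp del: times_divide_eq_left)
next
  case False
  with assms have "t > 0" by simp
  have "((\<lambda>a. t powr a) has_real_derivative t powr 1 * ln t) (at 1)"
    using \<open>t > 0\<close> by (auto intro!: derivative_eq_intros)
  then have "((\<lambda>a. (t powr a - t) / (a - 1)) \<longlongrightarrow> t * ln t) (at 1)"
    using \<open>t > 0\<close> by (simp add: has_field_derivative_iff)
  moreover have "filterlim a (at 1) sequentially"
    using a by (simp add: filterlim_at)
  ultimately have "(\<lambda>n. (t powr a n - t) / (a n - 1)) \<longlonglongrightarrow> t * ln t"
    by (rule filterlim_compose)
  then have "(\<lambda>n. a n * (1 - t + (t powr a n - t) / (a n - 1))) \<longlonglongrightarrow> 1 * (1 - t + t * ln t)"
    by (intro tendsto_intros a)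
  moreover have "a n * (1 - t + (t powr a n - t) / (a n - 1)) = a n / (1 - a n) * (a n * t + (1 - a n) - t powr a n)" for n
    using a(2)[of n] by (simp add: field_simps)
  moreover have "1 * (1 - t + t * ln t) = t * ln t - t + 1" by simp
  ultimately show ?thesis by (simp only:)
qed

context conditional_kernels
begin

lemma nn_integral_dens: "(\<integral>\<^sup>+w. ennreal (dens w) \<partial>M) = 1"
  using nn_integral_P[of "\<lambda>_. 1"] by (simp add: measure_pmf.emeasure_space_1[simplified])

text \<open>The gap and \<open>dens w powr \<alpha>\<close> together integrate to
  \<open>\<alpha> + (1 - \<alpha>)\<close>. The normaliser is at most the integral of the second
  part, since \<open>c(z) powr (1 / \<alpha>) \<le> c(z)\<close>.\<close>

lemma nn_integral_young_gap_add_normalizer: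
  assumes \<alpha>: "0 < \<alpha>" "\<alpha> < 1"
  shows "(\<integral>\<^sup>+w. ennreal (\<alpha> * dens w + (1 - \<alpha>) - dens w powr \<alpha>) \<partial>M) + ennreal (normalizer \<alpha>) \<le> 1" (is "?A + _ \<le> _")
proof -
  let ?C = "\<integral>\<^sup>+w. ennreal (dens w powr \<alpha>) \<partial>M"
  have gap: "0 \<le> \<alpha> * dens w + (1 - \<alpha>) - dens w powr \<alpha>" for w
    using young_powr_1[OF \<alpha>, OF dens_nonneg] by simp
  have "?A + ?C = (\<integral>\<^sup>+w. ennreal \<alpha> * ennreal (dens w) + ennreal (1 - \<alpha>) \<partial>M)"
    using gap \<alpha> by (subst nn_integral_add[symmetric])
      (auto intro!: nn_integral_cong simp: ennreal_plus[symmetric] ennreal_mult[symmetric] simp del: ennreal_plus)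
  also have "\<dots> = ennreal \<alpha> + ennreal (1 - \<alpha>)"
    by (simp add: nn_integral_add nn_integral_cmult nn_integral_dens measure_pmf.emeasure_space_1[simplified])
  also have "\<dots> = 1" using \<alpha> by (simp add: ennreal_plus[symmetric] del: ennreal_plus)
  finally have AC: "?A + ?C = 1" .
  have "ennreal (normalizer \<alpha>) \<le> (\<integral>\<^sup>+z. ennreal (cond_hellinger \<alpha> z) \<partial>PZ)"
    unfolding normalizer[OF \<alpha>]
    by (intro nn_integral_mono_AE) (auto simp: AE_measure_pmf_iff intro!: ennreal_leI cond_hellinger_powr_le \<alpha>)
  also have "\<dots> = ?C"
    unfolding nn_integral_M
    by (intro nn_integral_cong_AE) (auto simp: AE_measure_pmf_iff cond_hellinger(1)[OF \<alpha>])
  finally show ?thesis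
    unfolding AC[symmetric] by (intro add_left_mono)
qed

lemma normalizer_le_1: "0 < \<alpha> \<Longrightarrow> \<alpha> < 1 \<Longrightarrow> normalizer \<alpha> \<le> 1"
  using nn_integral_young_gap_add_normalizer[of \<alpha>] order_trans[OF add_increasing[of _ "ennreal (normalizer \<alpha>)", OF _ order_refl]]
  by fastforce

text \<open>Follows from \<open>1 - N \<le> - ln N\<close> for the normaliser \<open>N\<close>.
  Multiplied by \<open>\<alpha> / (1 - \<alpha>)\<close>, the right-hand side becomes the minimal
  divergence of order \<open>\<alpha>\<close>.\<close>

lemma nn_integral_young_gap_le:
  assumes \<alpha>: "0 < \<alpha>" "\<alpha> < 1"
  shows "(\<integral>\<^sup>+w. ennreal (\<alpha> * dens w + (1 - \<alpha>) - dens w powr \<alpha>) \<partial>M) \<le> ennreal (- ln (normalizer \<alpha>))" (is "?A \<le> _")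
proof -
  have "?A + ennreal (normalizer \<alpha>) \<le> 1" by (rule nn_integral_young_gap_add_normalizer[OF \<alpha>])
  moreover from this have "?A \<noteq> top" by (auto simp: top_unique)
  then obtain a where a: "?A = ennreal a" "0 \<le> a" by (cases ?A) auto
  ultimately have "a + normalizer \<alpha> \<le> 1"
    using normalizer_pos[OF \<alpha>] by (simp add: ennreal_plus[symmetric] del: ennreal_plus)
  then have "a \<le> - ln (normalizer \<alpha>)" using ln_le_minus_one[OF normalizer_pos[OF \<alpha>]] by simp
  then show ?thesis unfolding a(1) by (rule ennreal_leI)
qed

text \<open>Log-densities change sign, so Fatou's lemma is applied to the nonnegative Young gaps
  instead. Their limit integrates to the Kullback-Leibler divergence of \<open>P\<close> from
  \<open>M\<close>, and \<open>M\<close> is one of the candidates in the infimum.\<close>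

lemma cond_mutual_info_1_le:
  "cond_mutual_info 1 P KX KY \<le> (SUP \<alpha>\<in>{0<..<1}. cond_mutual_info \<alpha> P KX KY)" (is "_ \<le> ?S")
proof (cases "?S = \<infinity>")
  case False
  define \<psi> where "\<psi> t = t * ln t - t + 1" for t :: real
  have \<psi>_nonneg: "0 \<le> \<psi> t" if "0 \<le> t" for t
  proof (cases "t = 0")
    case False
    with that have "ln (1 / t) \<le> 1 / t - 1" by (intro ln_le_minus_one) auto
    then have "t * ln (1 / t) \<le> t * (1 / t - 1)" using that by (intro mult_left_mono)
    with that False show ?thesis by (simp add: \<psi>_def ln_div algebra_simps)
  qed (simp add: \<psi>_def)
  have S: "ereal (\<alpha> / (1 - \<alpha>) * - ln (normalizer \<alpha>)) \<le> ?S" if "0 < \<alpha>" "\<alpha> < 1" for \<alpha>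
    using that by (subst cond_mutual_info_eq[symmetric]) (auto intro!: SUP_upper)
  have "?S \<noteq> -\<infinity>" using S[of "1 / 2"] by auto
  with False obtain s where s: "?S = ereal s" by (cases ?S) auto
  \<comment> \<open>The shift by two keeps every order strictly between 0 and 1, starting from
    \<open>1 / 2\<close>.\<close>
  define a where "a n = 1 - inverse (real (Suc (Suc n)))" for n
  have a: "0 < a n" "a n < 1" for n by (auto simp: a_def field_simps)
  have lim: "a \<longlonglongrightarrow> 1"
    unfolding a_def using LIMSEQ_Suc[OF LIMSEQ_inverse_real_of_nat_add_minus[of 1]] by simp
  have "(\<integral>\<^sup>+w. ennreal (\<psi> (dens w)) \<partial>M)
      = (\<integral>\<^sup>+w. liminf (\<lambda>n. ennreal (a n / (1 - a n) * (a n * dens w + (1 - a n) - dens w powr a n))) \<partial>M)"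
  proof (intro nn_integral_cong lim_imp_Liminf[symmetric] tendsto_ennrealI)
    fix w
    show "(\<lambda>n. a n / (1 - a n) * (a n * dens w + (1 - a n) - dens w powr a n)) \<longlonglongrightarrow> \<psi> (dens w)"
      unfolding \<psi>_def using a(2) by (intro young_gap_tendsto lim) (auto simp: less_le)
  qed simp
  also have "\<dots> \<le> liminf (\<lambda>n. \<integral>\<^sup>+w. ennreal (a n / (1 - a n) * (a n * dens w + (1 - a n) - dens w powr a n)) \<partial>M)"
    by (rule nn_integral_liminf) simp
  also have "\<dots> \<le> ennreal s"
  proof -
    have "(\<integral>\<^sup>+w. ennreal (a n / (1 - a n) * (a n * dens w + (1 - a n) - dens w powr a n)) \<partial>M) \<le> ennreal s" for n
    proof -
      have "(\<integral>\<^sup>+w. ennreal (a n / (1 - a n) * (a n * dens w + (1 - a n) - dens w powr a n)) \<partial>M)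
          = ennreal (a n / (1 - a n)) * (\<integral>\<^sup>+w. ennreal (a n * dens w + (1 - a n) - dens w powr a n) \<partial>M)"
        using a[of n] by (simp add: ennreal_mult' nn_integral_cmult del: times_divide_eq_left)
      also have "\<dots> \<le> ennreal (a n / (1 - a n)) * ennreal (- ln (normalizer (a n)))"
        by (intro mult_left_mono nn_integral_young_gap_le a) simp
      also have "\<dots> = ennreal (a n / (1 - a n) * - ln (normalizer (a n)))"
        using a[of n] by (intro ennreal_mult'[symmetric]) simp
      also have "\<dots> \<le> ennreal s" using S[OF a, of n] unfolding s by (intro ennreal_leI) simp
      finally show ?thesis .
    qed
    then have "liminf (\<lambda>n. \<integral>\<^sup>+w. ennreal (a n / (1 - a n) * (a n * dens w + (1 - a n) - dens w powr a n)) \<partial>M)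
        \<le> liminf (\<lambda>n::nat. ennreal s)"
      by (intro Liminf_mono) simp
    then show ?thesis by (simp add: Liminf_const)
  qed
  finally have le: "(\<integral>\<^sup>+w. ennreal (\<psi> (dens w)) \<partial>M) \<le> ennreal s" .
  have int_\<psi>: "integrable M (\<lambda>w. \<psi> (dens w))"
    using le by (intro integrableI_nonneg) (auto simp: \<psi>_nonneg intro: le_less_trans)
  have s_nonneg: "0 \<le> s"
    using S[of "1 / 2"] normalizer_le_1[of "1 / 2"] ln_le_minus_one[OF normalizer_pos[of "1 / 2"]] by (simp add: s)
  have int_\<psi>_le: "(\<integral>w. \<psi> (dens w) \<partial>M) \<le> s"
    using le s_nonneg by (subst (asm) nn_integral_eq_integral[OF int_\<psi>]) (auto simp: \<psi>_nonneg)
  have int_dens: "integrable M dens"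
    using nn_integral_dens by (intro integrableI_nonneg) auto
  have dens_1: "(\<integral>w. dens w \<partial>M) = 1"
    using nn_integral_dens by (subst (asm) nn_integral_eq_integral[OF int_dens]) auto
  \<comment> \<open>The correction \<open>dens w - 1\<close> integrates to 0 under \<open>M\<close>,
    so integrating \<open>\<psi>\<close> yields the divergence itself.\<close>
  have eq: "dens w * ln (dens w) = \<psi> (dens w) + dens w - 1" for w by (simp add: \<psi>_def)
  have P: "measure_pmf P = density M (\<lambda>w. ennreal (dens w))"
  proof (rule measure_eqI)
    fix A
    show "emeasure P A = emeasure (density M (\<lambda>w. ennreal (dens w))) A"
      using nn_integral_P[of "indicator A"] by (simp add: emeasure_density)
  qed simp
  \<comment> \<open>Without integrability the divergence of order one would be infinite by
    definition.\<close>
  have "integrable P (\<lambda>w. ln (dens w))"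
    unfolding P by (subst integrable_density) (auto simp: eq intro!: integrable_diff integrable_add int_\<psi> int_dens)
  then have "renyi_divergence 1 P M = ereal (\<integral>w. ln (dens w) \<partial>P)"
    unfolding dens_def by (rule renyi_divergence_1[OF set_P_subset_M])
  also have "(\<integral>w. ln (dens w) \<partial>P) = (\<integral>w. dens w * ln (dens w) \<partial>M)"
    unfolding P by (subst integral_density) auto
  also have "\<dots> = (\<integral>w. \<psi> (dens w) \<partial>M)"
    unfolding eq using int_\<psi> int_dens by (simp add: dens_1)
  finally have "renyi_divergence 1 P M \<le> ?S" using int_\<psi>_le by (simp add: s)
  moreover have "cond_mutual_info 1 P KX KY \<le> renyi_divergence 1 P M"
    unfolding cond_mutual_info_def M_def by (rule INF_lower) simp
  ultimately show ?thesis by (rule order_trans[rotated])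
qed simp

end


subsection \<open>Biconjugates of the boundary of a planar region\<close>

text \<open>\<open>W l\<close> is the largest intercept of a line of slope \<open>- l\<close> below
  the boundary function, so the claim is that affine minorants of negative slope suffice for the
  biconjugate. A positive slope would make the whole plane belong to \<open>R\<close>, and slope 0
  is a limit of negative slopes.\<close>

lemma biconjugate_region:
  fixes R :: "real \<Rightarrow> real \<Rightarrow> bool" and W :: "real \<Rightarrow> real" and x :: real
  assumes mono: "\<And>y x y' x'. R y x \<Longrightarrow> y' \<le> y \<Longrightarrow> x' \<le> x \<Longrightarrow> R y' x'"
    and neg: "\<And>y x. x < 0 \<Longrightarrow> R y x"
    and W: "\<And>l b. l > 0 \<Longrightarrow> (\<forall>y x. y + l * x < b \<longrightarrow> R y x) \<longleftrightarrow> b \<le> W l"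
  shows "convex_conjugate (convex_conjugate (\<lambda>x. Sup (ereal ` {y. R y x}))) x
       = (SUP l\<in>{0<..}. ereal (W l - l * x))"
proof -
  define f where "f = (\<lambda>x. Sup (ereal ` {y. R y x}))"
  \<comment> \<open>The supremum need not be attained, so only heights strictly below
    \<open>c\<close> can be required to lie in the region.\<close>
  have le_f: "ereal c \<le> f z \<longleftrightarrow> (\<forall>y<c. R y z)" for c z
  proof
    assume c: "ereal c \<le> f z"
    show "\<forall>y<c. R y z"
    proof (intro allI impI)
      fix y assume "y < c"
      then have "ereal y < f z" using c by (meson less_ereal.simps(1) less_le_trans)
      then obtain y' where "R y' z" "y < y'" unfolding f_def less_Sup_iff by auto
      then show "R y z" by (meson mono less_imp_le order_refl)
    qed
  next
    assume R: "\<forall>y<c. R y z"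
    show "ereal c \<le> f z"
    proof (rule ccontr)
      assume "\<not> ereal c \<le> f z"
      then obtain y where y: "f z < ereal y" "ereal y < ereal c" by (meson ereal_dense2 not_le)
      with R have "ereal y \<le> f z" unfolding f_def by (intro Sup_upper) auto
      with y show False by simp
    qed
  qed
  have "convex_conjugate (convex_conjugate f) x = (SUP l\<in>{0<..}. ereal (W l - l * x))"
  proof (intro antisym)
    show "(SUP l\<in>{0<..}. ereal (W l - l * x)) \<le> convex_conjugate (convex_conjugate f) x"
    proof (intro SUP_least)
      fix l :: real assume "l \<in> {0<..}"
      then have l: "l > 0" by simp
      have "convex_conjugate f (- l) \<le> ereal (- W l)"
        unfolding convex_conjugate_def
      proof (intro SUP_least)
        fix z
        have "\<forall>y<W l - l * z. R y z" using W[OF l, of "W l"] by (simp add: algebra_simps)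
        then have "ereal (W l - l * z) \<le> f z" by (simp add: le_f)
        then show "ereal (- l * z) - f z \<le> ereal (- W l)" by (cases "f z") auto
      qed
      then have "ereal (W l - l * x) \<le> ereal (x * (- l)) - convex_conjugate f (- l)"
        by (cases "convex_conjugate f (- l)") (auto simp: mult.commute)
      also have "\<dots> \<le> convex_conjugate (convex_conjugate f) x"
        unfolding convex_conjugate_def[of "convex_conjugate f"] by (rule SUP_upper) simp
      finally show "ereal (W l - l * x) \<le> convex_conjugate (convex_conjugate f) x" .
    qed
    show "convex_conjugate (convex_conjugate f) x \<le> (SUP l\<in>{0<..}. ereal (W l - l * x))" (is "_ \<le> ?S")
      unfolding convex_conjugate_def[of "convex_conjugate f"]
    proof (intro SUP_least, rule ccontr)
      fix m :: real
      assume "\<not> ereal (x * m) - convex_conjugate f m \<le> ?S"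
      then obtain r where r: "?S < ereal r" "ereal r < ereal (x * m) - convex_conjugate f m"
        by (meson ereal_dense2 not_le)
      define b where "b = r - m * x"
      have cb: "convex_conjugate f m \<le> ereal (- b)"
        using r(2) by (cases "convex_conjugate f m") (auto simp: b_def mult.commute)
      have minorant: "R y z" if "y < m * z + b" for y z
      proof -
        have "ereal (m * z) - f z \<le> ereal (- b)"
          by (rule order_trans[OF _ cb], unfold convex_conjugate_def, rule SUP_upper) simp
        then have "ereal (m * z + b) \<le> f z" by (cases "f z") auto
        with that show ?thesis by (simp add: le_f)
      qed
      have S: "ereal (W l - l * x) \<le> ?S" if "l > 0" for l
        by (rule SUP_upper) (use that in auto)
      consider "m < 0" | "m = 0" | "m > 0" by linarith
      then show False
      proof cases
        case 1
        have "b \<le> W (- m)" using W[of "- m" b] 1 minorant by (auto simp: algebra_simps)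
        then have "ereal r \<le> ereal (W (- m) - (- m) * x)" by (simp add: b_def)
        also have "\<dots> \<le> ?S" using 1 by (intro S) auto
        finally show False using r(1) by simp
      next
        \<comment> \<open>The horizontal minorant at height \<open>r\<close> is tilted to slope
          \<open>- l\<close>, with \<open>l\<close> so small that it loses at most
          \<open>r - s\<close> at \<open>x\<close>. To the right of 0 the tilted line lies below the
          horizontal one; to the left \<open>neg\<close> applies.\<close>
        case 2
        obtain s where s: "?S < ereal s" "s < r" using ereal_dense2[OF r(1)] by auto
        define l where "l = (r - s) / (\<bar>x\<bar> + 1)"
        have l: "l > 0" using s(2) by (simp add: l_def)
        have "R y z" if "y + l * z < r" for y z
        proof (cases "z < 0")
          case False
          then have "0 \<le> l * z" using l by auto
          with that 2 show ?thesis by (intro minorant) (simp add: b_def)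
        qed (rule neg)
        then have "r \<le> W l" using W[OF l, of r] by blast
        moreover have "l * x \<le> r - s"
        proof -
          have "l * x \<le> l * (\<bar>x\<bar> + 1)" using l by (intro mult_left_mono) auto
          also have "\<dots> = r - s" by (simp add: l_def)
          finally show ?thesis .
        qed
        ultimately have "ereal s \<le> ereal (W l - l * x)" by simp
        also have "\<dots> \<le> ?S" by (rule S[OF l])
        finally show False using s(1) by simp
      next
        \<comment> \<open>Far enough to the right the minorant exceeds any height, and monotonicity
          then fills the plane, which the finite value \<open>W 1\<close> excludes.\<close>
        case 3
        have R: "R y z" for y z
        proof (rule mono[OF minorant])
          have "y < m * ((y - b) / m + 1) + b" using 3 by (simp add: field_simps)
          also have "\<dots> \<le> m * max z ((y - b) / m + 1) + b" using 3 by simp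
          finally show "y < m * max z ((y - b) / m + 1) + b" .
        qed auto
        have "W 1 + 1 \<le> W 1" by (intro W[THEN iffD1] allI impI R) simp
        then show False by simp
      qed
    qed
  qed
  then show ?thesis by (simp add: f_def)
qed

text \<open>The weights \<open>(\<alpha>, 1 - \<alpha>)\<close> correspond to the slope
  \<open>- (1 - \<alpha>) / \<alpha>\<close> for the first exponent function and to
  \<open>- \<alpha> / (1 - \<alpha>)\<close> for the second. This yields suprema over the open
  interval; the endpoint \<open>\<alpha> = 1\<close> is then shown not to increase them.\<close>

theorem theorem6:
  fixes P :: "('x \<times> 'y \<times> 'z) pmf"
    and KX :: "'z \<Rightarrow> 'x pmf"
    and KY :: "'z \<Rightarrow> 'y pmf"
  assumes "is_conditional_pmf (map_pmf (\<lambda>(x, y, z). (x, z)) P) KX"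
    and "is_conditional_pmf (map_pmf (\<lambda>(x, y, z). (y, z)) P) KY"
  shows "(\<forall>eQ :: real.
            convex_conjugate (convex_conjugate (exponent_P P KX KY)) eQ =
            (SUP \<alpha>\<in>{0<..1}. ereal ((1 - \<alpha>) / \<alpha>) * (cond_mutual_info \<alpha> P KX KY - ereal eQ))) \<and>
         (\<forall>eP :: real.
            convex_conjugate (convex_conjugate (exponent_Q P KX KY)) eP =
            (SUP \<alpha>\<in>{0<..1}. penalized \<alpha> (cond_mutual_info \<alpha> P KX KY) eP))"
proof (intro conjI allI)
  interpret conditional_kernels P KX KY by unfold_locales (fact assms)+
  have "\<forall>\<alpha>\<in>{0<..<1}. \<exists>i. cond_mutual_info \<alpha> P KX KY = ereal i \<and>
    (\<forall>v. (\<forall>eP eQ. \<alpha> * eP + (1 - \<alpha>) * eQ < v \<longrightarrow> achievable P KX KY eP eQ) \<longleftrightarrow> v \<le> (1 - \<alpha>) * i)"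
    using all_achievable_iff by auto
  then obtain i where i: "\<And>\<alpha>. \<alpha> \<in> {0<..<1} \<Longrightarrow> cond_mutual_info \<alpha> P KX KY = ereal (i \<alpha>)"
    and ach: "\<And>\<alpha> v. \<alpha> \<in> {0<..<1} \<Longrightarrow>
      (\<forall>eP eQ. \<alpha> * eP + (1 - \<alpha>) * eQ < v \<longrightarrow> achievable P KX KY eP eQ) \<longleftrightarrow> v \<le> (1 - \<alpha>) * i \<alpha>"
    by (metis (no_types, lifting))
  have ivl: "{0<..1} = insert 1 {0<..<1::real}" by auto
  \<comment> \<open>If a positively weighted sum of \<open>eP\<close> and \<open>eQ\<close> is
    negative, one of them is negative, and a constant test achieves the pair. Thus
    \<open>v = 0\<close> is admissible.\<close>
  have i_nonneg: "0 \<le> i \<alpha>" if "\<alpha> \<in> {0<..<1}" for \<alpha>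
  proof -
    have "achievable P KX KY eP eQ" if "\<alpha> * eP + (1 - \<alpha>) * eQ < 0" for eP eQ
    proof -
      have "eP < 0 \<or> eQ < 0"
        using that \<open>\<alpha> \<in> {0<..<1}\<close>
        by (smt (verit) greaterThanLessThan_iff mult_nonneg_nonneg)
      then show ?thesis by (auto intro: achievable_neg_P achievable_neg_Q)
    qed
    then have "0 \<le> (1 - \<alpha>) * i \<alpha>" using ach[OF that, of 0] by blast
    with that show ?thesis by (simp add: zero_le_mult_iff)
  qed
  {
    fix eQ :: real
    define W where "W l = l * i (1 / (1 + l))" for l
    have "convex_conjugate (convex_conjugate (\<lambda>x. Sup (ereal ` {y. achievable P KX KY y x}))) eQ
        = (SUP l\<in>{0<..}. ereal (W l - l * eQ))"
    proof (rule biconjugate_region)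
      fix l b :: real assume l: "0 < l"
      define \<alpha> where "\<alpha> = 1 / (1 + l)"
      have a: "\<alpha> \<in> {0<..<1}" "1 - \<alpha> = \<alpha> * l" using l by (auto simp: \<alpha>_def field_simps)
      have "y + l * x < b \<longleftrightarrow> \<alpha> * y + (1 - \<alpha>) * x < \<alpha> * b" for y x
      proof -
        have "\<alpha> * y + (1 - \<alpha>) * x < \<alpha> * b \<longleftrightarrow> \<alpha> * (y + l * x) < \<alpha> * b"
          unfolding a(2) by (simp add: algebra_simps)
        with a(1) show ?thesis by simp
      qed
      then show "(\<forall>y x. y + l * x < b \<longrightarrow> achievable P KX KY y x) \<longleftrightarrow> b \<le> W l"
        using ach[OF a(1), of "\<alpha> * b"] a(1) unfolding a(2) W_def \<alpha>_def[symmetric] by (simp add: mult.assoc)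
    qed (auto intro: achievable_mono achievable_neg_Q)
    also have "\<dots> = (SUP l\<in>(\<lambda>\<alpha>. (1 - \<alpha>) / \<alpha>) ` {0<..<1}. ereal (W l - l * eQ))"
    proof (rule arg_cong[of _ _ "\<lambda>S. Sup ((\<lambda>l. ereal (W l - l * eQ)) ` S)"], intro equalityI subsetI)
      fix l :: real assume "l \<in> {0<..}"
      then show "l \<in> (\<lambda>\<alpha>. (1 - \<alpha>) / \<alpha>) ` {0<..<1}"
        by (intro image_eqI[of _ _ "1 / (1 + l)"]) (auto simp: field_simps)
    qed auto
    also have "\<dots> = (SUP \<alpha>\<in>{0<..<1}. ereal ((1 - \<alpha>) / \<alpha>) * (cond_mutual_info \<alpha> P KX KY - ereal eQ))"
      unfolding image_image
    proof (intro SUP_cong refl)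
      fix \<alpha> :: real assume a: "\<alpha> \<in> {0<..<1}"
      then have "1 / (1 + (1 - \<alpha>) / \<alpha>) = \<alpha>" by (simp add: field_simps)
      with a show "ereal (W ((1 - \<alpha>) / \<alpha>) - (1 - \<alpha>) / \<alpha> * eQ)
          = ereal ((1 - \<alpha>) / \<alpha>) * (cond_mutual_info \<alpha> P KX KY - ereal eQ)"
        by (simp add: W_def i right_diff_distrib)
    qed
    also have "\<dots> = (SUP \<alpha>\<in>{0<..1}. ereal ((1 - \<alpha>) / \<alpha>) * (cond_mutual_info \<alpha> P KX KY - ereal eQ))"
    proof -
      let ?g = "\<lambda>\<alpha>. ereal ((1 - \<alpha>) / \<alpha>) * (cond_mutual_info \<alpha> P KX KY - ereal eQ)"
      \<comment> \<open>The endpoint term is 0, also when the divergence is infinite. It is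
        approached by slopes \<open>l\<close> near 0: nonnegativity of \<open>i\<close> leaves only
        the loss \<open>l * eQ\<close>, at most \<open>e\<close>.\<close>
      have "0 \<le> (SUP \<alpha>\<in>{0<..<1}. ?g \<alpha>)"
      proof (rule ereal_le_epsilon2)
        fix e :: real assume e: "0 < e"
        define l where "l = e / (\<bar>eQ\<bar> + 1)"
        define \<alpha> where "\<alpha> = 1 / (1 + l)"
        have l: "l > 0" using e by (simp add: l_def)
        then have a: "\<alpha> \<in> {0<..<1}" "(1 - \<alpha>) / \<alpha> = l" by (auto simp: \<alpha>_def field_simps)
        have "l * eQ \<le> l * (\<bar>eQ\<bar> + 1)" using l by (intro mult_left_mono) auto
        also have "\<dots> = e" by (simp add: l_def)
        finally have "0 \<le> l * (i \<alpha> - eQ) + e"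
          using l i_nonneg[OF a(1)] by (simp add: right_diff_distrib) (smt (verit) mult_nonneg_nonneg)
        then have "0 \<le> ?g \<alpha> + ereal e" using a by (simp add: i)
        also have "\<dots> \<le> (SUP \<alpha>\<in>{0<..<1}. ?g \<alpha>) + ereal e"
          by (intro add_right_mono SUP_upper a)
        finally show "0 \<le> (SUP \<alpha>\<in>{0<..<1}. ?g \<alpha>) + ereal e" .
      qed
      then show ?thesis unfolding ivl by (simp add: max_absorb2 flip: zero_ereal_def)
    qed
    finally show "convex_conjugate (convex_conjugate (exponent_P P KX KY)) eQ =
        (SUP \<alpha>\<in>{0<..1}. ereal ((1 - \<alpha>) / \<alpha>) * (cond_mutual_info \<alpha> P KX KY - ereal eQ))"
      unfolding exponent_P_def .
  next
    fix eP :: real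
    define W where "W l = i (l / (1 + l))" for l
    have "convex_conjugate (convex_conjugate (\<lambda>x. Sup (ereal ` {y. achievable P KX KY x y}))) eP
        = (SUP l\<in>{0<..}. ereal (W l - l * eP))"
    proof (rule biconjugate_region)
      fix l b :: real assume l: "0 < l"
      define \<alpha> where "\<alpha> = l / (1 + l)"
      have a: "\<alpha> \<in> {0<..<1}" "\<alpha> = (1 - \<alpha>) * l" using l by (auto simp: \<alpha>_def field_simps)
      have "y + l * x < b \<longleftrightarrow> \<alpha> * x + (1 - \<alpha>) * y < (1 - \<alpha>) * b" for y x
      proof -
        have "\<alpha> * x + (1 - \<alpha>) * y = (1 - \<alpha>) * (y + l * x)"
          by (subst a(2)) (simp add: algebra_simps)
        with a(1) show ?thesis by simp
      qed
      then show "(\<forall>y x. y + l * x < b \<longrightarrow> achievable P KX KY x y) \<longleftrightarrow> b \<le> W l"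
        using ach[OF a(1), of "(1 - \<alpha>) * b"] a(1) unfolding W_def \<alpha>_def[symmetric] by auto
    qed (auto intro: achievable_mono achievable_neg_P)
    also have "\<dots> = (SUP l\<in>(\<lambda>\<alpha>. \<alpha> / (1 - \<alpha>)) ` {0<..<1}. ereal (W l - l * eP))"
    proof (rule arg_cong[of _ _ "\<lambda>S. Sup ((\<lambda>l. ereal (W l - l * eP)) ` S)"], intro equalityI subsetI)
      fix l :: real assume "l \<in> {0<..}"
      then show "l \<in> (\<lambda>\<alpha>. \<alpha> / (1 - \<alpha>)) ` {0<..<1}"
        by (intro image_eqI[of _ _ "l / (1 + l)"]) (auto simp: field_simps)
    qed auto
    also have "\<dots> = (SUP \<alpha>\<in>{0<..<1}. penalized \<alpha> (cond_mutual_info \<alpha> P KX KY) eP)"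
      unfolding image_image
    proof (intro SUP_cong refl)
      fix \<alpha> :: real assume a: "\<alpha> \<in> {0<..<1}"
      then have "\<alpha> / (1 - \<alpha>) / (1 + \<alpha> / (1 - \<alpha>)) = \<alpha>" by (simp add: field_simps)
      with a show "ereal (W (\<alpha> / (1 - \<alpha>)) - \<alpha> / (1 - \<alpha>) * eP)
          = penalized \<alpha> (cond_mutual_info \<alpha> P KX KY) eP"
        by (simp add: W_def i penalized_def)
    qed
    also have "\<dots> = (SUP \<alpha>\<in>{0<..1}. penalized \<alpha> (cond_mutual_info \<alpha> P KX KY) eP)"
    proof -
      let ?g = "\<lambda>\<alpha>. penalized \<alpha> (cond_mutual_info \<alpha> P KX KY) eP"
      \<comment> \<open>By the conventions at order one, the endpoint term is
        \<open>-\<infinity>\<close> for positive \<open>eP\<close>, the divergence of order one at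
        0, and \<open>\<infinity>\<close> for negative \<open>eP\<close>. In the last case the other
        terms are unbounded as \<open>\<alpha>\<close> tends to 1.\<close>
      have "?g 1 \<le> (SUP \<alpha>\<in>{0<..<1}. ?g \<alpha>)"
      proof -
        consider "eP > 0" | "eP = 0" | "eP < 0" by linarith
        then show ?thesis
        proof cases
          case 1
          then show ?thesis by (simp add: penalized_def)
        next
          case 2
          then have "(SUP \<alpha>\<in>{0<..<1}. ?g \<alpha>) = (SUP \<alpha>\<in>{0<..<1}. cond_mutual_info \<alpha> P KX KY)"
            by (intro SUP_cong refl) (auto simp: penalized_def zero_ereal_def[symmetric])
          with 2 cond_mutual_info_1_le show ?thesis by (simp add: penalized_def)
        next
          case 3
          have "(SUP \<alpha>\<in>{0<..<1}. ?g \<alpha>) = \<infinity>"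
          proof (rule ereal_top)
            fix B :: real
            \<comment> \<open>Chosen so that \<open>- (l * eP)\<close> equals
              \<open>\<bar>B\<bar> + 1\<close>.\<close>
            define l where "l = (\<bar>B\<bar> + 1) / (- eP)"
            define \<alpha> where "\<alpha> = l / (1 + l)"
            have l: "l > 0" using 3 unfolding l_def by (intro divide_pos_pos) auto
            then have a: "\<alpha> \<in> {0<..<1}" "\<alpha> / (1 - \<alpha>) = l" by (auto simp: \<alpha>_def field_simps)
            have "B \<le> \<bar>B\<bar> + 1" by simp
            also have "\<dots> = - (l * eP)" using 3 by (simp add: l_def)
            also have "\<dots> \<le> i \<alpha> - l * eP" using i_nonneg[OF a(1)] by simp
            finally have "ereal B \<le> ?g \<alpha>" using a by (simp add: penalized_def i)
            also have "\<dots> \<le> (SUP \<alpha>\<in>{0<..<1}. ?g \<alpha>)" by (intro SUP_upper a)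
            finally show "ereal B \<le> (SUP \<alpha>\<in>{0<..<1}. ?g \<alpha>)" .
          qed
          then show ?thesis by simp
        qed
      qed
      then show ?thesis unfolding ivl by (simp add: max_absorb2)
    qed
    finally show "convex_conjugate (convex_conjugate (exponent_Q P KX KY)) eP =
        (SUP \<alpha>\<in>{0<..1}. penalized \<alpha> (cond_mutual_info \<alpha> P KX KY) eP)"
      unfolding exponent_Q_def .
  }
qed

end
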